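(* Let $p\ge 2$ and suppose $z(t)\in L^p(\Omega,\mathbb P)$ for every $t\in[0,T]$ and $\int_0^T \mathbb E[|z(t)|^p]^{2/p}\,dt<+\infty$. Let $F:[0,T]\times\mathbb R\to\mathbb R$ satisfy: (i) $F(t,\xi)\ge 0$ for all $(t,\xi)$; (ii) $F(t,\xi)$ is twice continuously differentiable in $\xi$ and $\frac{\partial F}{\partial \xi}$, $\frac{\partial^2 F}{\partial \xi^2}$ are continuous functions of both variables; (iii) there exist $\alpha\in(0,p)$ and a non-negative $L\in L^1(0,T)$ such that $|F(t,\xi)|+\left|\frac{\partial F}{\partial \xi}(t,\xi)\right|+\left|\frac{\partial^2 F}{\partial \xi^2}(t,\xi)\right|\le L(t)(1+|\xi|^\alpha)$ for all $t\in[0,T]$, $\xi\in\mathbb R$; (iv) for every fixed $t\in[0,T]$ the function $\xi\mapsto F(t,\xi)$ is strictly convex. Suppose that $J$ admits a global minimizer over $L^1(0,T)$, $\overline u\in L^{\widetilde p}(0,T)$, for some $\widetilde p>2\sqrt2$, and let $\Psi(t)=t^{\widetilde p}$. For each $\delta>0$ let $\overline u_{\delta,\Psi}\in L^1(0,T)$ be the minimizer of $J_{\delta,\Psi}$ over $L^1(0,T)$. Let $X_0\in L^2(\Omega,\mathbb P)$. Then there exists a sequence $\delta_n\to0$ such that $\mathcal S_{X_0}\overline u_{\delta_n,\Psi}\Rightarrow\mathcal S_{X_0}\overline u$ in distribution in $C([0,T])$.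
   Context: Fix $T>0$, a filtered probability space $(\Omega,\mathcal F,(\mathcal F_t)_{t\ge 0},\mathbb P)$ and an $\mathcal F_t$-Brownian motion $W$ (started at $0$). $a:[0,T]\to\mathbb R$ is a deterministic function in $L^\infty(0,T)$, $A(t)=\int_0^t a(s)\,ds$, $G(t)=e^{W(t)-t/2}$. $z$ is a real $\mathcal F_t$-adapted, jointly measurable process; $F$ is Borel measurable; $X_0$ is $\mathcal F_0$-measurable. $L^1(0,T)$ denotes deterministic integrable real functions (identified when equal a.e.). For $u\in L^1(0,T)$, $$\mathcal S_{X_0}u(t)=G(t)e^{A(t)}\left(X_0+\int_0^t\frac{e^{-A(s)}}{G(s)}u(s)\,ds\right),\quad t\in[0,T],$$ i.e. the solution of $dX=[a(t)X+u(t)]dt+X\,dW(t)$, $X(0)=X_0$. Also $$\xi_u(t)=G(t)e^{A(t)}\int_0^t\frac{e^{-A(s)}}{G(s)}(z(s)-u(s))\,ds,\qquad J[u]=\mathbb E\left[\int_0^T F(t,\xi_u(t))\,dt\right],$$ and, for $\delta>0$, $J_{\delta,\Psi}[u]=J[u]+\delta\int_0^T\Psi(|u(t)|)\,dt\in[0,+\infty]$. Under the hypotheses of the claim $J_{\delta,\Psi}$ has a unique minimizer for every $\delta>0$. $C([0,T])$ carries the sup norm. *)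

theory Defs
  imports "HOL-Analysis.Analysis" "HOL-Probability.Probability"
begin

section \<open>Filtered probability spaces and Brownian motion\<close>

text \<open>Time is \<open>real\<close>; only indices \<open>t \<ge> 0\<close> are ever constrained. (The library locale
  \<open>filtration\<close> would constrain negative times as well.)\<close>

definition filtered_prob_space :: "'a measure \<Rightarrow> (real \<Rightarrow> 'a measure) \<Rightarrow> bool" where
  "filtered_prob_space M Fil \<longleftrightarrow> prob_space M \<and>
     (\<forall>t\<ge>0. subalgebra M (Fil t)) \<and>
     (\<forall>s t. 0 \<le> s \<and> s \<le> t \<longrightarrow> sets (Fil s) \<subseteq> sets (Fil t))"

text \<open>The starting value and the continuity of the paths are only required almost surely.\<close>

definition brownian_motion ::
    "'a measure \<Rightarrow> (real \<Rightarrow> 'a measure) \<Rightarrow> (real \<Rightarrow> 'a \<Rightarrow> real) \<Rightarrow> bool" where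
  "brownian_motion M Fil W \<longleftrightarrow>
     (\<forall>t\<ge>0. W t \<in> borel_measurable (Fil t)) \<and>
     (AE \<omega> in M. W 0 \<omega> = 0) \<and>
     (\<forall>s t. 0 \<le> s \<and> s < t \<longrightarrow>
        distributed M lborel (\<lambda>\<omega>. W t \<omega> - W s \<omega>) (normal_density 0 (sqrt (t - s))) \<and>
        prob_space.indep_set M (sets (Fil s))
          (sets (vimage_algebra (space M) (\<lambda>\<omega>. W t \<omega> - W s \<omega>) borel))) \<and>
     (AE \<omega> in M. continuous_on {0..} (\<lambda>t. W t \<omega>))"


section \<open>Function classes\<close>

definition in_Lp :: "'b measure \<Rightarrow> real \<Rightarrow> ('b \<Rightarrow> real) \<Rightarrow> bool" where
  "in_Lp M p f \<longleftrightarrow> f \<in> borel_measurable M \<and> integrable M (\<lambda>x. \<bar>f x\<bar> powr p)"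

definition in_Linf :: "'b measure \<Rightarrow> ('b \<Rightarrow> real) \<Rightarrow> bool" where
  "in_Linf M f \<longleftrightarrow> f \<in> borel_measurable M \<and> (\<exists>C. AE x in M. \<bar>f x\<bar> \<le> C)"

text \<open>Elements of \<open>L\<^sup>1(0,T)\<close> are represented by functions rather than by classes; all functionals
  below depend only on the class.\<close>

abbreviation in_L1 :: "real \<Rightarrow> (real \<Rightarrow> real) \<Rightarrow> bool" where
  "in_L1 T u \<equiv> integrable (lebesgue_on {0..T}) u"

definition strictly_convex :: "(real \<Rightarrow> real) \<Rightarrow> bool" where
  "strictly_convex f \<longleftrightarrow>
     (\<forall>x y c. x \<noteq> y \<and> 0 < c \<and> c < 1 \<longrightarrow>
        f ((1 - c) * x + c * y) < (1 - c) * f x + c * f y)"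


section \<open>The controlled process and the cost functionals\<close>

definition drift_int :: "(real \<Rightarrow> real) \<Rightarrow> real \<Rightarrow> real" where
  "drift_int a t = (\<integral>s. a s \<partial>lebesgue_on {0..t})"

definition geom_bm :: "(real \<Rightarrow> 'a \<Rightarrow> real) \<Rightarrow> real \<Rightarrow> 'a \<Rightarrow> real" where
  "geom_bm W t \<omega> = exp (W t \<omega> - t / 2)"

definition sol_map :: "(real \<Rightarrow> real) \<Rightarrow> (real \<Rightarrow> 'a \<Rightarrow> real) \<Rightarrow> ('a \<Rightarrow> real) \<Rightarrow>
    (real \<Rightarrow> real) \<Rightarrow> real \<Rightarrow> 'a \<Rightarrow> real" where
  "sol_map a W X0 u t \<omega> = geom_bm W t \<omega> * exp (drift_int a t) *
     (X0 \<omega> + (\<integral>s. exp (- drift_int a s) / geom_bm W s \<omega> * u s \<partial>lebesgue_on {0..t}))"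

definition xi_proc :: "(real \<Rightarrow> real) \<Rightarrow> (real \<Rightarrow> 'a \<Rightarrow> real) \<Rightarrow> (real \<Rightarrow> 'a \<Rightarrow> real) \<Rightarrow>
    (real \<Rightarrow> real) \<Rightarrow> real \<Rightarrow> 'a \<Rightarrow> real" where
  "xi_proc a W z u t \<omega> = geom_bm W t \<omega> * exp (drift_int a t) *
     (\<integral>s. exp (- drift_int a s) / geom_bm W s \<omega> * (z s \<omega> - u s) \<partial>lebesgue_on {0..t})"

text \<open>The costs take values in \<open>[0,\<infinity>]\<close>. The use of \<open>ennreal\<close> loses nothing,
  because \<open>F\<close> and \<open>\<Psi>\<close> are non-negative where they are evaluated.\<close>

definition cost :: "'a measure \<Rightarrow> real \<Rightarrow> (real \<Rightarrow> real) \<Rightarrow> (real \<Rightarrow> 'a \<Rightarrow> real) \<Rightarrow>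
    (real \<Rightarrow> 'a \<Rightarrow> real) \<Rightarrow> (real \<Rightarrow> real \<Rightarrow> real) \<Rightarrow> (real \<Rightarrow> real) \<Rightarrow> ennreal" where
  "cost M T a W z F u =
     (\<integral>\<^sup>+ \<omega>. (\<integral>\<^sup>+ t. ennreal (F t (xi_proc a W z u t \<omega>)) \<partial>lebesgue_on {0..T}) \<partial>M)"

definition pen_cost :: "'a measure \<Rightarrow> real \<Rightarrow> (real \<Rightarrow> real) \<Rightarrow> (real \<Rightarrow> 'a \<Rightarrow> real) \<Rightarrow>
    (real \<Rightarrow> 'a \<Rightarrow> real) \<Rightarrow> (real \<Rightarrow> real \<Rightarrow> real) \<Rightarrow> (real \<Rightarrow> real) \<Rightarrow> real \<Rightarrow>
    (real \<Rightarrow> real) \<Rightarrow> ennreal" where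
  "pen_cost M T a W z F \<Psi> \<delta> u =
     cost M T a W z F u + ennreal \<delta> * (\<integral>\<^sup>+ t. ennreal (\<Psi> \<bar>u t\<bar>) \<partial>lebesgue_on {0..T})"


section \<open>Convergence in distribution in \<open>C([0,T])\<close>\<close>

text \<open>Elements of \<open>C([0,T])\<close> are functions that are \<open>undefined\<close> outside \<open>{0..T}\<close>.\<close>

definition C_metric :: "real \<Rightarrow> (real \<Rightarrow> real) metric" where
  "C_metric T = cfunspace (top_of_set {0..T}) euclidean_metric"

lemma mspace_C_metric:
  "mspace (C_metric T) = {f \<in> extensional {0..T}. continuous_on {0..T} f}"
proof -
  have "bounded (f ` {0..T})" if "continuous_on {0..T} f" for f :: "real \<Rightarrow> real"
    using compact_continuous_image[OF that] compact_imp_bounded by blast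
  then show ?thesis
    unfolding C_metric_def by auto
qed

lemma mdist_C_metric:
  assumes "T > 0" "f \<in> mspace (C_metric T)" "g \<in> mspace (C_metric T)"
  shows "mdist (C_metric T) f g = (SUP t\<in>{0..T}. \<bar>f t - g t\<bar>)"
proof -
  have "f \<in> Met_TC.fspace {0..T}" "g \<in> Met_TC.fspace {0..T}"
    using assms(2,3) cfunspace_subset_funspace[of "top_of_set {0..T}" "euclidean_metric :: real metric"]
    unfolding C_metric_def by (auto simp del: mspace_cfunspace)
  then have "mdist (funspace {0..T} euclidean_metric) f g = (SUP t\<in>{0..T}. dist (f t) (g t))"
    using assms(1) by (simp add: Met_TC.fdist_def)
  then show ?thesis
    by (simp add: C_metric_def mdist_cfunspace_eq_mdist_funspace dist_real_def)
qed

definition C_borel :: "real \<Rightarrow> (real \<Rightarrow> real) measure" where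
  "C_borel T = sigma (mspace (C_metric T)) {U. openin (mtopology_of (C_metric T)) U}"

text \<open>\<open>Y\<close> is a \<open>C([0,T])\<close>-valued random variable that agrees, almost surely and for all
  \<open>t \<in> [0,T]\<close> simultaneously, with the real process \<open>X\<close>. When \<open>X\<close> has almost surely continuous
  paths such a \<open>Y\<close> is almost surely unique, and its distribution is the law of \<open>X\<close> in \<open>C([0,T])\<close>.\<close>

definition C_version ::
    "'a measure \<Rightarrow> real \<Rightarrow> (real \<Rightarrow> 'a \<Rightarrow> real) \<Rightarrow> ('a \<Rightarrow> real \<Rightarrow> real) \<Rightarrow> bool" where
  "C_version M T X Y \<longleftrightarrow>
     Y \<in> measurable M (C_borel T) \<and> (AE \<omega> in M. \<forall>t\<in>{0..T}. Y \<omega> t = X t \<omega>)"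

definition weak_conv_C :: "real \<Rightarrow> (nat \<Rightarrow> (real \<Rightarrow> real) measure) \<Rightarrow> (real \<Rightarrow> real) measure \<Rightarrow> bool"
  where
  "weak_conv_C T \<mu> \<nu> \<longleftrightarrow>
     (\<forall>\<Phi>. continuous_map (mtopology_of (C_metric T)) euclideanreal \<Phi> \<and>
          bounded (\<Phi> ` mspace (C_metric T)) \<longrightarrow>
        (\<lambda>n. \<integral>f. \<Phi> f \<partial>\<mu> n) \<longlonglongrightarrow> (\<integral>f. \<Phi> f \<partial>\<nu>))"

definition conv_in_distr_C ::
    "'a measure \<Rightarrow> real \<Rightarrow> (nat \<Rightarrow> real \<Rightarrow> 'a \<Rightarrow> real) \<Rightarrow> (real \<Rightarrow> 'a \<Rightarrow> real) \<Rightarrow> bool" where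
  "conv_in_distr_C M T Xs X \<longleftrightarrow>
     (\<exists>Ys Y. (\<forall>n. C_version M T (Xs n) (Ys n)) \<and> C_version M T X Y \<and>
        weak_conv_C T (\<lambda>n. distr M (C_borel T) (Ys n)) (distr M (C_borel T) Y))"

end

theory Submission
  imports Defs
begin

text \<open>With \<open>g(t) = G(t) e\<^bsup>A(t)\<^esup>\<close> both \<open>\<xi>\<^sub>u\<close> and \<open>\<S>\<^sub>X u\<close> are built from the map
  \<open>f \<mapsto> g(t) \<integral>\<^sub>0\<^sup>t f(s) / g(s) ds\<close>. Almost surely \<open>g\<close> is continuous and positive on \<open>[0,T]\<close>, hence bounded
  above and away from \<open>0\<close> there, so along almost every path this map is continuous from \<open>L\<^sup>1(0,T)\<close>
  to \<open>C([0,T])\<close>. It is therefore enough that the penalized minimizers \<open>u\<^sub>\<delta>\<close> converge to \<open>ubar\<close> in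
  \<open>L\<^sup>1(0,T)\<close> as \<open>\<delta> \<down> 0\<close>: the states then converge uniformly on \<open>[0,T]\<close>, almost surely, which is
  stronger than convergence in distribution. The parameters \<open>\<delta>\<^sub>n = 1/(n+1)\<close> serve.

  Convergence of \<open>u\<^sub>\<delta>\<close> is a matter of Tikhonov regularization
  (\<open>Tikhonov_minimizers_L1_converge\<close>). Write \<open>q\<close> for the exponent of the penalty and
  \<open>N(u) = \<integral> \<bar>u\<bar>\<^sup>q\<close>. Comparing the two minimizers for \<open>\<delta> \<le> \<delta>'\<close> with each other shows that
  \<open>N(u\<^sub>\<delta>)\<close> increases and \<open>J(u\<^sub>\<delta>)\<close> decreases as \<open>\<delta>\<close> decreases, and comparison with \<open>ubar\<close> gives
  \<open>N(u\<^sub>\<delta>) \<le> N(ubar)\<close>. By convexity the midpoint \<open>w\<close> of \<open>u\<^sub>\<delta>\<close> and \<open>u\<^sub>\<delta>'\<close> has \<open>J(w) \<le> J(u\<^sub>\<delta>')\<close>, so minimality of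
  \<open>u\<^sub>\<delta>'\<close> forces \<open>N(u\<^sub>\<delta>') \<le> N(w)\<close>, and Clarkson's inequality turns this into
  \<open>N((u\<^sub>\<delta> - u\<^sub>\<delta>') / 2) \<le> (N(u\<^sub>\<delta>) - N(u\<^sub>\<delta>')) / 2\<close>. As \<open>N(u\<^sub>\<delta>)\<close> is monotone and bounded, \<open>u\<^sub>\<delta>\<close> is Cauchy
  in \<open>L\<^sup>q\<close>, a fortiori in \<open>L\<^sup>1\<close>, and has a limit \<open>v\<close> in \<open>L\<^sup>1\<close>.

  The limit is \<open>ubar\<close>. By Fatou's lemma \<open>J(v) \<le> lim J(u\<^sub>\<delta>) = J(ubar)\<close>
  (\<open>J_lower_semicontinuous\<close>), so \<open>v\<close> minimizes \<open>J\<close> as well; strict convexity of \<open>F(t, \<cdot>)\<close> makes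
  \<open>\<xi>\<^sub>u\<close> the same for all minimizers, and on a single path \<open>\<xi>\<^sub>u\<close> determines \<open>u\<close> up to a null set
  (\<open>minimizer_unique\<close>).

  All of this presupposes \<open>J(ubar) < \<infinity>\<close>, for otherwise every control would minimize \<open>J\<close>. This is where
  the moments of \<open>z\<close> and the growth of \<open>F\<close> enter: \<open>J(0) < \<infinity>\<close> (\<open>J_zero_finite\<close>), because
  \<open>g(t) / g(s)\<close> is a bounded factor times the exponential of a Gaussian variable and has all moments,
  so that \<open>\<xi>\<^sub>0(t)\<close> inherits from \<open>z\<close> its moments of every order below \<open>p\<close>, uniformly in \<open>t\<close>.\<close>

section \<open>Elementary inequalities for powers\<close>

lemma powr_superadditive:
  fixes x y r :: real
  assumes "0 \<le> x" "0 \<le> y" "1 \<le> r"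
  shows "x powr r + y powr r \<le> (x + y) powr r"
proof (cases "x + y = 0")
  case True
  then have "x = 0" "y = 0" using assms by auto
  then show ?thesis by simp
next
  case False
  define s where "s = x + y"
  have s: "s > 0" using False assms by (simp add: s_def)
  have part: "c powr r \<le> c / s * s powr r" if c: "0 \<le> c" "c \<le> s" for c
  proof (cases "c = 0")
    case False
    then have "(c / s) powr r \<le> c / s"
      using c s assms(3) by (intro powr_le_one_le) auto
    then show ?thesis using s by (simp add: powr_divide field_simps)
  qed (use assms in auto)
  have "x powr r + y powr r \<le> x / s * s powr r + y / s * s powr r"
    using assms by (intro add_mono part) (auto simp: s_def)
  also have "\<dots> = (x / s + y / s) * s powr r" by (simp only: distrib_right)
  also have "x / s + y / s = 1" using s by (simp add: s_def flip: add_divide_distrib)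
  finally show ?thesis by (simp add: s_def)
qed

lemma powr_midpoint_convex:
  fixes x y r :: real
  assumes "0 \<le> x" "0 \<le> y" "1 \<le> r"
  shows "((x + y) / 2) powr r \<le> (x powr r + y powr r) / 2"
proof -
  have half: "(c / 2) powr r \<le> c powr r / 2" if "0 \<le> c" for c :: real
    using powr_superadditive[of "c/2" "c/2" r] that assms(3) by simp
  show ?thesis
  proof (cases "x = 0 \<or> y = 0")
    case True
    then show ?thesis using half[of x] half[of y] assms by auto
  next
    case False
    then have "x > 0" "y > 0" using assms by auto
    then show ?thesis
      using convex_onD[OF powr_convex[OF assms(3)], of "1/2" x y] by (simp add: field_simps)
  qed
qed

text \<open>Superadditivity of \<open>x \<mapsto> x powr (q/2)\<close> combines the two squares on the left into
  \<open>(x\<^sup>2 + y\<^sup>2) / 2\<close> by the parallelogram law, and convexity of the same function splits this mean.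
  Both properties need \<open>q \<ge> 2\<close>.\<close>

lemma Clarkson_pointwise:
  fixes x y q :: real
  assumes "2 \<le> q"
  shows "\<bar>(x + y) / 2\<bar> powr q + \<bar>(x - y) / 2\<bar> powr q \<le> (\<bar>x\<bar> powr q + \<bar>y\<bar> powr q) / 2"
proof -
  have sq: "\<bar>c\<bar> powr q = (c\<^sup>2) powr (q / 2)" for c :: real
    using powr_powr[of "\<bar>c\<bar>" 2 "q/2"] by (cases "c = 0") simp_all
  have "\<bar>(x + y) / 2\<bar> powr q + \<bar>(x - y) / 2\<bar> powr q
      \<le> (((x + y) / 2)\<^sup>2 + ((x - y) / 2)\<^sup>2) powr (q / 2)"
    unfolding sq using assms by (intro powr_superadditive) auto
  also have "((x + y) / 2)\<^sup>2 + ((x - y) / 2)\<^sup>2 = (x\<^sup>2 + y\<^sup>2) / 2"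
    by (simp add: power2_eq_square field_simps)
  also have "((x\<^sup>2 + y\<^sup>2) / 2) powr (q / 2) \<le> (\<bar>x\<bar> powr q + \<bar>y\<bar> powr q) / 2"
    unfolding sq using assms by (intro powr_midpoint_convex) auto
  finally show ?thesis .
qed

text \<open>A value above the level \<open>c\<close> is paid for by its \<open>q\<close>-th power. Integrated, this bounds \<open>L\<^sup>1\<close> norms
  over finite measures by \<open>L\<^sup>q\<close> norms, with a level that can be chosen afterwards.\<close>

lemma le_truncate_powr:
  fixes x q c :: real
  assumes "0 \<le> x" "1 \<le> q" "0 < c"
  shows "x \<le> c + c powr (1 - q) * x powr q"
proof (cases "x \<le> c")
  case True
  then show ?thesis by (simp add: add_increasing2)
next
  case False
  then have "c powr (q - 1) \<le> x powr (q - 1)"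
    using assms by (intro powr_mono2) auto
  then have "c powr (1 - q) * c powr (q - 1) \<le> c powr (1 - q) * x powr (q - 1)"
    by (intro mult_left_mono) auto
  then have "1 \<le> c powr (1 - q) * x powr (q - 1)"
    using assms by (simp flip: powr_add)
  then have "x * 1 \<le> x * (c powr (1 - q) * x powr (q - 1))"
    using assms by (intro mult_left_mono) auto
  also have "\<dots> = c powr (1 - q) * x powr q"
    using False assms by (simp add: powr_diff)
  finally show ?thesis using assms by simp
qed

text \<open>Jensen's inequality for the measure with density \<open>w\<close>, up to the factor \<open>2 powr \<beta>\<close>. Truncating \<open>f\<close>
  at half of its mean yields it at once.\<close>

lemma powr_integral_le_integral_powr:
  fixes f w :: "'b \<Rightarrow> real"
  assumes \<beta>: "1 \<le> \<beta>" and f: "\<And>x. x \<in> space \<mu> \<Longrightarrow> 0 \<le> f x" and w: "\<And>x. x \<in> space \<mu> \<Longrightarrow> 0 \<le> w x"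
    and int: "integrable \<mu> w" "integrable \<mu> (\<lambda>x. f x * w x)" "integrable \<mu> (\<lambda>x. f x powr \<beta> * w x)"
    and pos: "0 < (\<integral>x. w x \<partial>\<mu>)"
  shows "(\<integral>x. f x * w x \<partial>\<mu>) powr \<beta>
    \<le> 2 powr \<beta> * (\<integral>x. w x \<partial>\<mu>) powr (\<beta> - 1) * (\<integral>x. f x powr \<beta> * w x \<partial>\<mu>)"
proof -
  define I where "I = (\<integral>x. f x * w x \<partial>\<mu>)"
  define V where "V = (\<integral>x. w x \<partial>\<mu>)"
  define Q where "Q = (\<integral>x. f x powr \<beta> * w x \<partial>\<mu>)"
  have I: "0 \<le> I" unfolding I_def using f w by (intro integral_nonneg_AE AE_I2) auto
  have Q: "0 \<le> Q" unfolding Q_def using w by (intro integral_nonneg_AE AE_I2) auto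
  have V: "0 < V" using pos by (simp add: V_def)
  show ?thesis
  proof (cases "I = 0")
    case True
    then show ?thesis using Q by (simp flip: I_def Q_def)
  next
    case False
    \<comment> \<open>With this level the truncated part accounts for exactly half of \<open>I\<close>.\<close>
    define c where "c = I / (2 * V)"
    have c: "c > 0" using False I V by (simp add: c_def)
    have "I \<le> (\<integral>x. c * w x + c powr (1 - \<beta>) * (f x powr \<beta> * w x) \<partial>\<mu>)"
      unfolding I_def
    proof (rule integral_mono)
      fix x assume x: "x \<in> space \<mu>"
      have "f x * w x \<le> (c + c powr (1 - \<beta>) * f x powr \<beta>) * w x"
        using le_truncate_powr[OF f[OF x] \<beta> c] w[OF x] by (rule mult_right_mono)
      then show "f x * w x \<le> c * w x + c powr (1 - \<beta>) * (f x powr \<beta> * w x)"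
        by (simp add: algebra_simps)
    qed (use int in auto)
    also have "\<dots> = c * V + c powr (1 - \<beta>) * Q"
      using int by (simp add: V_def Q_def)
    also have "c * V = I / 2" using V by (simp add: c_def)
    finally have "I / 2 \<le> c powr (1 - \<beta>) * Q" by simp
    then have "c powr (\<beta> - 1) * (I / 2) \<le> c powr (\<beta> - 1) * (c powr (1 - \<beta>) * Q)"
      by (intro mult_left_mono) auto
    also have "\<dots> = Q" using c by (simp flip: powr_add mult.assoc)
    also have "I / 2 = c * V" using V by (simp add: c_def)
    also have "c powr (\<beta> - 1) * (c * V) = c powr \<beta> * V"
      using c by (simp add: powr_diff)
    finally have "c powr \<beta> * V \<le> Q" .
    moreover have "I powr \<beta> = 2 powr \<beta> * V powr (\<beta> - 1) * (c powr \<beta> * V)"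
    proof -
      have "I = 2 * V * c" using V by (simp add: c_def)
      then have "I powr \<beta> = 2 powr \<beta> * V powr \<beta> * c powr \<beta>" by (simp add: powr_mult)
      then show ?thesis using V by (simp add: powr_diff)
    qed
    ultimately show ?thesis
      by (simp add: mult_left_mono flip: I_def V_def Q_def)
  qed
qed

text \<open>Young's inequality for the conjugate exponents \<open>p / (p - \<beta>)\<close> and \<open>p / \<beta>\<close>, without their weights:
  whichever factor dominates absorbs the other one.\<close>

lemma Young_powr:
  fixes x y \<beta> p :: real
  assumes "0 \<le> x" "0 \<le> y" "0 < \<beta>" "\<beta> < p"
  shows "(x * y) powr \<beta> \<le> x powr (\<beta> * p / (p - \<beta>)) + y powr p"
proof (cases "x = 0 \<or> y = 0")
  case True
  then show ?thesis by auto
next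
  case False
  then have xy: "0 < x" "0 < y" using assms by auto
  show ?thesis
  proof (cases "y powr (p - \<beta>) \<le> x powr \<beta>")
    case True
    then have "(y powr (p - \<beta>)) powr (\<beta> / (p - \<beta>)) \<le> (x powr \<beta>) powr (\<beta> / (p - \<beta>))"
      using assms by (intro powr_mono2) auto
    then have "y powr \<beta> \<le> x powr (\<beta> * \<beta> / (p - \<beta>))"
      using assms by (simp add: powr_powr)
    then have "x powr \<beta> * y powr \<beta> \<le> x powr \<beta> * x powr (\<beta> * \<beta> / (p - \<beta>))"
      by (intro mult_left_mono) auto
    also have "\<dots> = x powr (\<beta> * p / (p - \<beta>))"
      using assms by (simp flip: powr_add) (simp add: field_simps)
    finally show ?thesis by (simp add: powr_mult add_increasing2)
  next
    case False
    then have "x powr \<beta> * y powr \<beta> \<le> y powr (p - \<beta>) * y powr \<beta>"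
      by (intro mult_right_mono) auto
    also have "\<dots> = y powr p" by (simp flip: powr_add)
    finally show ?thesis by (simp add: powr_mult add_increasing)
  qed
qed

section \<open>Completeness of L1 and Tikhonov regularization\<close>

text \<open>The proof of Riesz and Fischer: along a subsequence the increments are absolutely summable in \<open>L\<^sup>1\<close>,
  hence pointwise almost everywhere, and the sum is the limit.\<close>

lemma L1_Cauchy_imp_convergent:
  fixes u :: "nat \<Rightarrow> 'b \<Rightarrow> real"
  assumes int [intro, simp]: "\<And>n. integrable \<mu> (u n)"
    and Cauchy: "\<And>e. e > 0 \<Longrightarrow> \<exists>N. \<forall>m\<ge>N. \<forall>n\<ge>N. (\<integral>x. \<bar>u m x - u n x\<bar> \<partial>\<mu>) < e"
  obtains v where "integrable \<mu> v" "(\<lambda>n. \<integral>x. \<bar>u n x - v x\<bar> \<partial>\<mu>) \<longlonglongrightarrow> 0"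
proof -
  define D where "D m n = (\<integral>x. \<bar>u m x - u n x\<bar> \<partial>\<mu>)" for m n
  have "\<forall>k. \<exists>N. \<forall>m\<ge>N. \<forall>n\<ge>N. D m n < (1/2)^k"
    using Cauchy unfolding D_def by (meson zero_less_divide_1_iff zero_less_numeral zero_less_power)
  then obtain N where N: "\<And>k m n. m \<ge> N k \<Longrightarrow> n \<ge> N k \<Longrightarrow> D m n < (1/2)^k"
    by metis
  \<comment> \<open>Summing makes the indices increase while still dominating \<open>N\<close>.\<close>
  define r where "r k = (\<Sum>j\<le>k. N j)" for k
  have r_ge: "r k \<ge> N k" for k unfolding r_def by (intro member_le_sum) auto
  have r_Suc: "r (Suc k) \<ge> N k" for k
    unfolding r_def by (intro member_le_sum) auto
  define w where "w k x = u (r (Suc k)) x - u (r k) x" for k x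
  have w_int: "integrable \<mu> (w k)" for k unfolding w_def by simp
  have w_norm: "(\<integral>x. norm (w k x) \<partial>\<mu>) \<le> (1/2)^k" for k
    using N[OF r_Suc[of k] r_ge[of k]] by (simp add: w_def D_def)
  have sum_norm: "summable (\<lambda>k. \<integral>x. norm (w k x) \<partial>\<mu>)"
    by (rule summable_comparison_test'[of "\<lambda>k. (1/2)^k" 0]) (use w_norm in auto)
  have AE_sum: "AE x in \<mu>. summable (\<lambda>k. norm (w k x))"
  proof -
    have "(\<integral>\<^sup>+x. (\<Sum>k. ennreal (norm (w k x))) \<partial>\<mu>) = (\<Sum>k. \<integral>\<^sup>+x. ennreal (norm (w k x)) \<partial>\<mu>)"
      using w_int by (intro nn_integral_suminf) auto
    also have "\<dots> = (\<Sum>k. ennreal (\<integral>x. norm (w k x) \<partial>\<mu>))"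
      by (intro suminf_cong nn_integral_eq_integral integrable_norm w_int) auto
    also have "\<dots> \<noteq> \<infinity>"
      using sum_norm by (simp add: ennreal_suminf_neq_top integral_nonneg_AE)
    finally have "AE x in \<mu>. (\<Sum>k. ennreal (norm (w k x))) \<noteq> \<infinity>"
      using w_int by (intro nn_integral_PInf_AE) (auto intro!: borel_measurable_suminf)
    then show ?thesis
      by eventually_elim (auto intro!: summable_suminf_not_top)
  qed
  define v where "v x = u (r 0) x + (\<Sum>k. w k x)" for x
  have v_int: "integrable \<mu> v"
    unfolding v_def using integrable_suminf[OF w_int AE_sum sum_norm] by simp
  have D_v: "(\<integral>x. \<bar>u (r k) x - v x\<bar> \<partial>\<mu>) \<le> 2 * (1/2)^k" for k
  proof -
    have sum_k: "summable (\<lambda>j. \<integral>x. norm (w (j + k) x) \<partial>\<mu>)"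
      using sum_norm by (rule summable_ignore_initial_segment)
    have AE_k: "AE x in \<mu>. summable (\<lambda>j. norm (w (j + k) x))"
      using AE_sum by eventually_elim (rule summable_ignore_initial_segment)
    have AE_k': "AE x in \<mu>. summable (\<lambda>j. norm (norm (w (j + k) x)))"
      using AE_k by simp
    have "(\<integral>x. \<bar>u (r k) x - v x\<bar> \<partial>\<mu>) \<le> (\<integral>x. (\<Sum>j. norm (w (j + k) x)) \<partial>\<mu>)"
    proof (rule integral_mono_AE)
      show "integrable \<mu> (\<lambda>x. \<Sum>j. norm (w (j + k) x))"
        using sum_k w_int AE_k' by (intro integrable_suminf) auto
      show "AE x in \<mu>. \<bar>u (r k) x - v x\<bar> \<le> (\<Sum>j. norm (w (j + k) x))"
        using AE_sum AE_k
      proof eventually_elim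
        case (elim x)
        have tele: "(\<Sum>j<k. w j x) = u (r k) x - u (r 0) x"
          unfolding w_def using sum_lessThan_telescope[of "\<lambda>j. u (r j) x" k] by simp
        have "(\<Sum>j. w j x) = (\<Sum>j. w (j + k) x) + (\<Sum>j<k. w j x)"
          using elim(1) by (intro suminf_split_initial_segment) (rule summable_norm_cancel)
        then have "u (r k) x - v x = - (\<Sum>j. w (j + k) x)"
          by (simp add: v_def tele)
        then show ?case using summable_norm[OF elim(2)] by simp
      qed
    qed (use v_int in auto)
    also have "\<dots> = (\<Sum>j. \<integral>x. norm (w (j + k) x) \<partial>\<mu>)"
      using sum_k w_int AE_k' by (intro integral_suminf) auto
    also have "\<dots> \<le> (\<Sum>j. (1/2)^k * (1/2)^j)"
      using sum_k w_norm
      by (intro suminf_le summable_mult summable_geometric) (auto simp: power_add mult.commute simp flip: power_add)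
    also have "\<dots> = 2 * (1/2)^k"
      by (subst suminf_mult) (auto simp: suminf_geometric summable_geometric)
    finally show ?thesis .
  qed
  have "(\<lambda>n. \<integral>x. \<bar>u n x - v x\<bar> \<partial>\<mu>) \<longlonglongrightarrow> 0"
  proof (rule LIMSEQ_I)
    fix e :: real assume "e > 0"
    then obtain k where k: "(1/2)^k < e / 3"
      using real_arch_pow_inv[of "e/3" "1/2"] by auto
    have "norm ((\<integral>x. \<bar>u n x - v x\<bar> \<partial>\<mu>) - 0) < e" if n: "n \<ge> N k" for n
    proof -
      have "(\<integral>x. \<bar>u n x - v x\<bar> \<partial>\<mu>) \<le> (\<integral>x. \<bar>u n x - u (r k) x\<bar> + \<bar>u (r k) x - v x\<bar> \<partial>\<mu>)"
        using v_int by (intro integral_mono) auto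
      also have "\<dots> = D n (r k) + (\<integral>x. \<bar>u (r k) x - v x\<bar> \<partial>\<mu>)"
        unfolding D_def using v_int by (intro Bochner_Integration.integral_add) auto
      also have "\<dots> < e"
        using N[OF n r_ge] D_v[of k] k by linarith
      finally show ?thesis by (simp add: integral_nonneg_AE)
    qed
    then show "\<exists>n0. \<forall>n\<ge>n0. norm ((\<integral>x. \<bar>u n x - v x\<bar> \<partial>\<mu>) - 0) < e" by blast
  qed
  with v_int that show thesis by blast
qed

text \<open>A penalty that is uniformly convex makes the penalized minimizers converge strongly, even if
  nothing but quasi-convexity at midpoints is known of \<open>J\<close>. The limit need not minimize \<open>J\<close> here, as no
  semicontinuity is assumed; the last conclusion is what identifies it when \<open>J\<close> is
  semicontinuous.\<close>

lemma Tikhonov_minimizers_L1_converge: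
  fixes \<mu> :: "'b measure" and J :: "('b \<Rightarrow> real) \<Rightarrow> ennreal" and q :: real
    and ubar :: "'b \<Rightarrow> real" and umin :: "real \<Rightarrow> 'b \<Rightarrow> real"
  assumes fin: "finite_measure \<mu>" and q: "2 \<le> q"
    and J_mid: "\<And>u v. integrable \<mu> u \<Longrightarrow> integrable \<mu> v \<Longrightarrow>
        J (\<lambda>x. (u x + v x) / 2) \<le> max (J u) (J v)"
    and ubar: "is_arg_min J (integrable \<mu>) ubar"
    and J_fin: "J ubar < \<infinity>"
    and ubar_q: "integrable \<mu> (\<lambda>x. \<bar>ubar x\<bar> powr q)"
    and umin: "\<And>\<delta>. \<delta> > 0 \<Longrightarrow>
        is_arg_min (\<lambda>u. J u + ennreal \<delta> * (\<integral>\<^sup>+x. ennreal (\<bar>u x\<bar> powr q) \<partial>\<mu>)) (integrable \<mu>) (umin \<delta>)"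
    and \<delta>: "\<And>n. \<delta> n > 0" "decseq \<delta>" "\<delta> \<longlonglongrightarrow> 0"
  obtains v where "integrable \<mu> v" "(\<lambda>n. \<integral>x. \<bar>umin (\<delta> n) x - v x\<bar> \<partial>\<mu>) \<longlonglongrightarrow> 0"
    "(\<lambda>n. J (umin (\<delta> n))) \<longlonglongrightarrow> J ubar"
proof -
  interpret finite_measure \<mu> by (fact fin)
  define pen where "pen \<epsilon> u = J u + ennreal \<epsilon> * (\<integral>\<^sup>+x. ennreal (\<bar>u x\<bar> powr q) \<partial>\<mu>)" for \<epsilon> u
  define N where "N u = (\<integral>x. \<bar>u x\<bar> powr q \<partial>\<mu>)" for u
  \<comment> \<open>On these controls the penalized cost is a real number, and the comparisons below can be made
    with real arithmetic.\<close>
  define adm where "adm u \<longleftrightarrow> integrable \<mu> u \<and> J u < \<infinity> \<and> integrable \<mu> (\<lambda>x. \<bar>u x\<bar> powr q)" for u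
  have N_nonneg: "N u \<ge> 0" for u unfolding N_def by (simp add: integral_nonneg_AE)
  have J_real: "ennreal (enn2real (J u)) = J u" if "adm u" for u
    using that by (simp add: adm_def)
  have pen_adm: "pen \<epsilon> u = ennreal (enn2real (J u) + \<epsilon> * N u)" if "adm u" "\<epsilon> > 0" for \<epsilon> u
  proof -
    have "(\<integral>\<^sup>+x. ennreal (\<bar>u x\<bar> powr q) \<partial>\<mu>) = ennreal (N u)"
      unfolding N_def using that by (intro nn_integral_eq_integral) (auto simp: adm_def)
    then have "pen \<epsilon> u = ennreal (enn2real (J u)) + ennreal \<epsilon> * ennreal (N u)"
      by (simp add: pen_def J_real[OF that(1)])
    also have "\<dots> = ennreal (enn2real (J u) + \<epsilon> * N u)"
      using that N_nonneg[of u] by (simp add: ennreal_mult ennreal_plus)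
    finally show ?thesis .
  qed
  have ubar_int: "integrable \<mu> ubar" and ubar_min: "\<And>u. integrable \<mu> u \<Longrightarrow> J ubar \<le> J u"
    using ubar by (auto simp: is_arg_min_linorder)
  have adm_ubar: "adm ubar"
    using ubar_int J_fin ubar_q by (simp add: adm_def)
  have umin_int: "integrable \<mu> (umin \<epsilon>)" if "\<epsilon> > 0" for \<epsilon>
    using umin[OF that] by (simp add: is_arg_min_def)
  have pen_le: "pen \<epsilon> (umin \<epsilon>) \<le> pen \<epsilon> u" if "\<epsilon> > 0" "integrable \<mu> u" for \<epsilon> u
    using umin[OF that(1)] that(2) by (auto simp: is_arg_min_linorder pen_def)
  have adm_umin: "adm (umin \<epsilon>)" if \<epsilon>: "\<epsilon> > 0" for \<epsilon>
  proof -
    have "pen \<epsilon> (umin \<epsilon>) < \<infinity>"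
      using pen_le[OF \<epsilon> ubar_int] pen_adm[OF adm_ubar \<epsilon>] by (simp add: le_less_trans)
    then have "J (umin \<epsilon>) < \<infinity>" "(\<integral>\<^sup>+x. ennreal (\<bar>umin \<epsilon> x\<bar> powr q) \<partial>\<mu>) < \<infinity>"
      using \<epsilon> by (auto simp: pen_def ennreal_mult_less_top)
    moreover have "integrable \<mu> (\<lambda>x. \<bar>umin \<epsilon> x\<bar> powr q)"
      using borel_measurable_integrable[OF umin_int[OF \<epsilon>]] calculation(2)
      by (intro integrableI_bounded) auto
    ultimately show ?thesis
      using umin_int[OF \<epsilon>] by (simp add: adm_def)
  qed
  define j where "j \<epsilon> = enn2real (J (umin \<epsilon>))" for \<epsilon>
  have min_real: "j \<epsilon> + \<epsilon> * N (umin \<epsilon>) \<le> enn2real (J u) + \<epsilon> * N u" if "\<epsilon> > 0" "adm u" for \<epsilon> u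
  proof -
    have "ennreal (j \<epsilon> + \<epsilon> * N (umin \<epsilon>)) \<le> ennreal (enn2real (J u) + \<epsilon> * N u)"
      using pen_le[OF that(1)] that unfolding j_def
      by (metis adm_def adm_umin pen_adm)
    then show ?thesis
      using that N_nonneg[of u] by (subst (asm) ennreal_le_iff) auto
  qed
  have min_ubar: "enn2real (J ubar) \<le> j \<epsilon>" if "\<epsilon> > 0" for \<epsilon>
    using ubar_min[OF umin_int[OF that]] adm_umin[OF that] unfolding j_def adm_def
    by (intro enn2real_mono) auto

  have N_antimono: "N (umin \<epsilon>') \<le> N (umin \<epsilon>)" if "0 < \<epsilon>" "\<epsilon> \<le> \<epsilon>'" for \<epsilon> \<epsilon>'
  proof (cases "\<epsilon> = \<epsilon>'")
    case False
    have "j \<epsilon> + \<epsilon> * N (umin \<epsilon>) \<le> j \<epsilon>' + \<epsilon> * N (umin \<epsilon>')"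
      using that min_real[of \<epsilon> "umin \<epsilon>'"] adm_umin[of \<epsilon>'] by (simp add: j_def)
    moreover have "j \<epsilon>' + \<epsilon>' * N (umin \<epsilon>') \<le> j \<epsilon> + \<epsilon>' * N (umin \<epsilon>)"
      using that min_real[of \<epsilon>' "umin \<epsilon>"] adm_umin[of \<epsilon>] by (simp add: j_def)
    ultimately have "(\<epsilon>' - \<epsilon>) * N (umin \<epsilon>') \<le> (\<epsilon>' - \<epsilon>) * N (umin \<epsilon>)"
      by (simp add: algebra_simps)
    then show ?thesis using that False by simp
  qed simp
  have j_mono: "j \<epsilon> \<le> j \<epsilon>'" if "0 < \<epsilon>" "\<epsilon> \<le> \<epsilon>'" for \<epsilon> \<epsilon>'
  proof -
    have "j \<epsilon> + \<epsilon> * N (umin \<epsilon>) \<le> j \<epsilon>' + \<epsilon> * N (umin \<epsilon>')"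
      using that min_real[of \<epsilon> "umin \<epsilon>'"] adm_umin[of \<epsilon>'] by (simp add: j_def)
    moreover have "\<epsilon> * N (umin \<epsilon>') \<le> \<epsilon> * N (umin \<epsilon>)"
      using N_antimono[OF that] that by simp
    ultimately show ?thesis by linarith
  qed
  have N_bound: "N (umin \<epsilon>) \<le> N ubar" if "\<epsilon> > 0" for \<epsilon>
  proof -
    have "\<epsilon> * N (umin \<epsilon>) \<le> \<epsilon> * N ubar"
      using min_real[OF that adm_ubar] min_ubar[OF that] by linarith
    then show ?thesis using that by simp
  qed

  \<comment> \<open>The midpoint \<open>w\<close> of the two minimizers costs no more than the one with the larger parameter, so its
    penalty cannot be smaller than that of the latter.\<close>
  have gap: "(\<integral>x. \<bar>(umin \<epsilon> x - umin \<epsilon>' x) / 2\<bar> powr q \<partial>\<mu>) \<le> (N (umin \<epsilon>) - N (umin \<epsilon>')) / 2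
      \<and> integrable \<mu> (\<lambda>x. \<bar>(umin \<epsilon> x - umin \<epsilon>' x) / 2\<bar> powr q)"
    if eps: "0 < \<epsilon>" "\<epsilon> \<le> \<epsilon>'" for \<epsilon> \<epsilon>'
  proof -
    let ?u = "umin \<epsilon>" and ?v = "umin \<epsilon>'"
    let ?w = "\<lambda>x. (?u x + ?v x) / 2"
    have adm2: "adm ?u" "adm ?v" using eps adm_umin by auto
    then have [measurable]: "?u \<in> borel_measurable \<mu>" "?v \<in> borel_measurable \<mu>"
      by (auto simp: adm_def)
    have dom: "integrable \<mu> (\<lambda>x. (\<bar>?u x\<bar> powr q + \<bar>?v x\<bar> powr q) / 2)"
      using adm2 by (auto simp: adm_def)
    have w_q: "integrable \<mu> (\<lambda>x. \<bar>?w x\<bar> powr q)"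
    proof (rule Bochner_Integration.integrable_bound[OF dom], measurable, rule AE_I2)
      fix x
      have "\<bar>?w x\<bar> powr q \<le> (\<bar>?u x\<bar> powr q + \<bar>?v x\<bar> powr q) / 2"
        using Clarkson_pointwise[OF q, of "?u x" "?v x"] powr_ge_zero[of "\<bar>(?u x - ?v x) / 2\<bar>" q] by linarith
      then show "norm (\<bar>?w x\<bar> powr q) \<le> norm ((\<bar>?u x\<bar> powr q + \<bar>?v x\<bar> powr q) / 2)"
        by (metis abs_ge_self abs_of_nonneg order_trans powr_ge_zero real_norm_def)
    qed
    have d_q: "integrable \<mu> (\<lambda>x. \<bar>(?u x - ?v x) / 2\<bar> powr q)"
    proof (rule Bochner_Integration.integrable_bound[OF dom], measurable, rule AE_I2)
      fix x
      have "\<bar>(?u x - ?v x) / 2\<bar> powr q \<le> (\<bar>?u x\<bar> powr q + \<bar>?v x\<bar> powr q) / 2"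
        using Clarkson_pointwise[OF q, of "?u x" "?v x"] powr_ge_zero[of "\<bar>?w x\<bar>" q] by linarith
      then show "norm (\<bar>(?u x - ?v x) / 2\<bar> powr q) \<le> norm ((\<bar>?u x\<bar> powr q + \<bar>?v x\<bar> powr q) / 2)"
        by (metis abs_ge_self abs_of_nonneg order_trans powr_ge_zero real_norm_def)
    qed
    have J_w: "J ?w \<le> max (J ?u) (J ?v)"
      using adm2 by (intro J_mid) (auto simp: adm_def)
    have "J ?u \<le> J ?v"
    proof -
      have "ennreal (j \<epsilon>) \<le> ennreal (j \<epsilon>')" using j_mono[OF eps] by (rule ennreal_leI)
      then show ?thesis unfolding j_def J_real[OF adm2(1)] J_real[OF adm2(2)] .
    qed
    with J_w have J_w': "J ?w \<le> J ?v" by (simp add: max_def)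
    have adm_w: "adm ?w"
      using adm2 w_q J_w' by (auto simp: adm_def intro: le_less_trans)
    have "j \<epsilon>' + \<epsilon>' * N ?v \<le> enn2real (J ?w) + \<epsilon>' * N ?w"
      using eps by (intro min_real adm_w) auto
    moreover have "enn2real (J ?w) \<le> j \<epsilon>'"
      unfolding j_def using J_w' adm2 by (intro enn2real_mono) (auto simp: adm_def)
    ultimately have "\<epsilon>' * N ?v \<le> \<epsilon>' * N ?w" by linarith
    then have N_w: "N ?v \<le> N ?w" using eps by simp
    have "N ?w + (\<integral>x. \<bar>(?u x - ?v x) / 2\<bar> powr q \<partial>\<mu>)
        = (\<integral>x. \<bar>?w x\<bar> powr q + \<bar>(?u x - ?v x) / 2\<bar> powr q \<partial>\<mu>)"
      unfolding N_def using w_q d_q by (rule Bochner_Integration.integral_add[symmetric])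
    also have "\<dots> \<le> (\<integral>x. (\<bar>?u x\<bar> powr q + \<bar>?v x\<bar> powr q) / 2 \<partial>\<mu>)"
      using w_q d_q dom Clarkson_pointwise[OF q] by (intro integral_mono) auto
    also have "\<dots> = (N ?u + N ?v) / 2"
      using adm2 by (simp add: N_def adm_def)
    finally show ?thesis using N_w d_q by (simp add: field_simps)
  qed

  define n where "n k = N (umin (\<delta> k))" for k
  have "incseq n"
    unfolding n_def by (intro incseq_SucI N_antimono \<delta> decseqD[OF \<delta>(2)]) auto
  moreover have "n k \<le> N ubar" for k unfolding n_def by (intro N_bound \<delta>)
  ultimately obtain l where l: "n \<longlonglongrightarrow> l"
    using incseq_convergent[of n "N ubar"] by metis

  have L1_small: "\<exists>K. \<forall>k\<ge>K. \<forall>m\<ge>K. (\<integral>x. \<bar>umin (\<delta> k) x - umin (\<delta> m) x\<bar> \<partial>\<mu>) < e"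
    if e: "e > 0" for e :: real
  proof -
    define V where "V = measure \<mu> (space \<mu>)"
    \<comment> \<open>The level \<open>c\<close> and the gap \<open>\<eta>\<close> each contribute at most \<open>e/8\<close> to the norm of half the difference;
      the summand \<open>1\<close> avoids dividing by the measure of a null space.\<close>
    define c where "c = e / (8 * (V + 1))"
    have V: "V \<ge> 0" by (simp add: V_def)
    then have c: "c > 0" using e by (simp add: c_def)
    define \<eta> where "\<eta> = e / (8 * c powr (1 - q))"
    have \<eta>: "\<eta> > 0" using e c by (simp add: \<eta>_def)
    obtain K where K: "\<And>k. k \<ge> K \<Longrightarrow> \<bar>n k - l\<bar> < \<eta>"
      using LIMSEQ_D[OF l \<eta>] by auto
    have ordered: "(\<integral>x. \<bar>umin (\<delta> k) x - umin (\<delta> m) x\<bar> \<partial>\<mu>) < e" if km: "K \<le> m" "m \<le> k" for k m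
    proof -
      let ?d = "\<lambda>x. (umin (\<delta> k) x - umin (\<delta> m) x) / 2"
      have g: "(\<integral>x. \<bar>?d x\<bar> powr q \<partial>\<mu>) \<le> (n k - n m) / 2" and g_int: "integrable \<mu> (\<lambda>x. \<bar>?d x\<bar> powr q)"
        using gap[of "\<delta> k" "\<delta> m"] \<delta>(1)[of k] decseqD[OF \<delta>(2) km(2)] by (auto simp: n_def)
      have d_int: "integrable \<mu> ?d" using umin_int \<delta>(1) by simp
      have "(\<integral>x. \<bar>?d x\<bar> \<partial>\<mu>) \<le> (\<integral>x. c + c powr (1 - q) * \<bar>?d x\<bar> powr q \<partial>\<mu>)"
        using d_int g_int c q le_truncate_powr[of "\<bar>?d x\<bar>" q c for x]
        by (intro integral_mono integrable_abs) auto
      also have "\<dots> = c * V + c powr (1 - q) * (\<integral>x. \<bar>?d x\<bar> powr q \<partial>\<mu>)"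
        using g_int by (simp add: V_def)
      also have "\<dots> \<le> c * V + c powr (1 - q) * \<eta>"
        using g K[of k] K[of m] km by (intro add_left_mono mult_left_mono) (auto simp: abs_if split: if_splits)
      also have "c * V \<le> e / 8"
        using V e by (simp add: c_def field_simps)
      also have "c powr (1 - q) * \<eta> = e / 8"
        using c by (simp add: \<eta>_def)
      finally have "(\<integral>x. \<bar>?d x\<bar> \<partial>\<mu>) \<le> e / 4" by simp
      moreover have "(\<integral>x. \<bar>?d x\<bar> \<partial>\<mu>) = (\<integral>x. \<bar>umin (\<delta> k) x - umin (\<delta> m) x\<bar> \<partial>\<mu>) / 2"
        by (simp add: abs_divide)
      ultimately show ?thesis using e by simp
    qed
    have "(\<integral>x. \<bar>umin (\<delta> k) x - umin (\<delta> m) x\<bar> \<partial>\<mu>) < e" if km: "K \<le> m" "K \<le> k" for k m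
      using ordered[of m k] ordered[of k m] km by (cases "m \<le> k") (auto simp: abs_minus_commute)
    then show ?thesis by blast
  qed
  obtain v where v: "integrable \<mu> v" "(\<lambda>n. \<integral>x. \<bar>umin (\<delta> n) x - v x\<bar> \<partial>\<mu>) \<longlonglongrightarrow> 0"
    by (rule L1_Cauchy_imp_convergent[of \<mu> "\<lambda>n. umin (\<delta> n)"]) (use umin_int \<delta>(1) L1_small in auto)

  \<comment> \<open>The cost of the minimizers exceeds that of \<open>ubar\<close> by at most the penalty of \<open>ubar\<close>, which vanishes
    in the limit.\<close>
  have "(\<lambda>k. j (\<delta> k)) \<longlonglongrightarrow> enn2real (J ubar)"
  proof (rule tendsto_sandwich)
    show "\<forall>\<^sub>F k in sequentially. enn2real (J ubar) \<le> j (\<delta> k)"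
      using min_ubar \<delta>(1) by simp
    show "\<forall>\<^sub>F k in sequentially. j (\<delta> k) \<le> enn2real (J ubar) + \<delta> k * N ubar"
    proof (rule always_eventually, rule allI)
      fix k
      have "j (\<delta> k) + \<delta> k * N (umin (\<delta> k)) \<le> enn2real (J ubar) + \<delta> k * N ubar"
        by (intro min_real adm_ubar \<delta>)
      moreover have "0 \<le> \<delta> k * N (umin (\<delta> k))" using N_nonneg \<delta>(1)[of k] by simp
      ultimately show "j (\<delta> k) \<le> enn2real (J ubar) + \<delta> k * N ubar" by linarith
    qed
    show "(\<lambda>k. enn2real (J ubar) + \<delta> k * N ubar) \<longlonglongrightarrow> enn2real (J ubar)"
      using \<delta>(3) by (auto intro!: tendsto_eq_intros)
  qed simp
  then have "(\<lambda>k. ennreal (j (\<delta> k))) \<longlonglongrightarrow> ennreal (enn2real (J ubar))"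
    by (rule tendsto_ennrealI)
  moreover have "ennreal (j (\<delta> k)) = J (umin (\<delta> k))" for k
    unfolding j_def by (intro J_real adm_umin \<delta>)
  ultimately have "(\<lambda>k. J (umin (\<delta> k))) \<longlonglongrightarrow> J ubar"
    using J_fin by (simp add: less_top)
  with v that show thesis by blast
qed

section \<open>Functions and processes on a time interval\<close>

lemma Icc_sets_lebesgue [simp, measurable]: "{a..b::real} \<in> sets lebesgue"
  by (metis cbox_interval fmeasurableD lmeasurable_cbox)

lemma continuous_Icc_open_interval:
  fixes h :: "real \<Rightarrow> real"
  assumes T: "0 < T" and h: "continuous_on {0..T} h" and t: "t \<in> {0..T}" and U: "open U" "h t \<in> U"
  obtains a b where "a < b" "{a<..<b} \<subseteq> {0..T}" "\<And>s. s \<in> {a<..<b} \<Longrightarrow> h s \<in> U"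
proof -
  have "\<forall>\<^sub>F s in at t within {0..T}. h s \<in> U"
    using h t U by (auto simp: continuous_on intro: topological_tendstoD)
  then obtain e where e: "e > 0" "\<And>s. s \<in> {0..T} \<Longrightarrow> dist s t < e \<Longrightarrow> h s \<in> U"
    using U(2) unfolding eventually_at by (metis dist_eq_0_iff)
  show thesis
  proof (cases "t < T")
    case True
    show ?thesis
      by (rule that[of t "min T (t + e)"]) (use True t e(1) in \<open>auto simp: dist_real_def intro!: e(2)\<close>)
  next
    case False
    show ?thesis
      by (rule that[of "max 0 (t - e)" t]) (use False t e(1) T in \<open>auto simp: dist_real_def intro!: e(2)\<close>)
  qed
qed

text \<open>Almost every point is a limit of averages over the intervals to its right, and all these
  averages vanish.\<close>

lemma zero_primitive_imp_AE_zero: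
  fixes f :: "real \<Rightarrow> real"
  assumes f: "integrable (lebesgue_on {0..T}) f"
    and zero: "\<And>t. t \<in> {0..T} \<Longrightarrow> (\<integral>s. f s \<partial>lebesgue_on {0..t}) = 0"
  shows "AE t in lebesgue_on {0..T}. f t = 0"
proof -
  define h where "h x = (if x \<in> {0..T} then f x else 0)" for x
  have h_UNIV: "h integrable_on UNIV"
    unfolding h_def Henstock_Kurzweil_Integration.integrable_restrict_UNIV
    using integrable_on_lebesgue_on[OF f] by simp
  have h_box: "h integrable_on cbox a b" for a b
    using h_UNIV by (rule integrable_on_subcbox) auto
  have prim: "integral {0..t} f = 0" if t: "t \<in> {0..T}" for t
  proof -
    have "integrable (lebesgue_on {0..t}) f"
      using integrable_subinterval[OF f, of 0 t] t by auto
    then show ?thesis using lebesgue_integral_eq_integral[of "{0..t}" f] zero[OF t] by simp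
  qed
  have local: "integral {x..x + d} h = 0" if x: "0 \<le> x" "0 < d" "x + d \<le> T" for x d
  proof -
    have "integral {x..x + d} h = integral {x..x + d} f"
      using x by (intro integral_cong) (auto simp: h_def)
    moreover have "integral {0..x} f + integral {x..x + d} f = integral {0..x + d} f"
    proof (rule Henstock_Kurzweil_Integration.integral_combine)
      have "integrable (lebesgue_on {0..x + d}) f"
        using integrable_subinterval[OF f, of 0 "x + d"] x by auto
      then show "f integrable_on {0..x + d}" by (rule integrable_on_lebesgue_on) simp
    qed (use x in auto)
    ultimately show ?thesis using prim[of x] prim[of "x + d"] x by auto
  qed
  obtain N where N: "negligible N" and N': "\<And>x e. \<lbrakk>x \<notin> N; 0 < e\<rbrakk> \<Longrightarrow> \<exists>d>0. \<forall>k. 0 < k \<and> k < d \<longrightarrow>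
      norm (integral (cbox x (x + k *\<^sub>R One)) h /\<^sub>R k ^ DIM(real) - h x) < e"
    using integrable_ccontinuous_explicit[OF h_box] by metis
  \<comment> \<open>The point \<open>T\<close> is left out because it has no interval of \<open>{0..T}\<close> to its right.\<close>
  have zero_off: "f x = 0" if x: "x \<notin> N \<union> {T}" "x \<in> {0..T}" for x
  proof (rule ccontr)
    assume "f x \<noteq> 0"
    then obtain d where d: "d > 0"
      "\<And>k. 0 < k \<Longrightarrow> k < d \<Longrightarrow> norm (integral (cbox x (x + k *\<^sub>R One)) h /\<^sub>R k ^ DIM(real) - h x) < \<bar>f x\<bar>"
      using N'[of x "\<bar>f x\<bar>"] x by auto
    define k where "k = min (d / 2) (T - x)"
    have k: "0 < k" "k < d" "x + k \<le> T" using d x by (auto simp: k_def min_def)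
    then show False using d(2)[of k] local[of x k] x by (simp add: h_def)
  qed
  have "N \<union> {T} \<in> null_sets lebesgue"
    using negligible_Un[OF N negligible_sing[of T]] by (simp only: negligible_iff_null_sets)
  then have "AE x in lebesgue. x \<notin> N \<union> {T}" by (rule AE_not_in)
  then have "AE x in lebesgue. x \<in> {0..T} \<longrightarrow> f x = 0"
    by eventually_elim (use zero_off in blast)
  then show ?thesis by (simp add: AE_restrict_space_iff)
qed

text \<open>At the grid times \<open>\<lfloor>nt\<rfloor> / n\<close> the process takes only countably many of its random variables, so the
  time-discretized process is jointly measurable, and by continuity it converges pointwise.\<close>

lemma borel_measurable_continuous_process:
  fixes g :: "real \<Rightarrow> 'a \<Rightarrow> real"
  assumes cont: "\<And>\<omega>. \<omega> \<in> space M \<Longrightarrow> continuous_on {0..T} (\<lambda>t. g t \<omega>)"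
    and meas: "\<And>t. t \<in> {0..T} \<Longrightarrow> g t \<in> borel_measurable M"
    and T: "0 \<le> T"
  shows "(\<lambda>(t, \<omega>). g t \<omega>) \<in> borel_measurable (lebesgue_on {0..T} \<Otimes>\<^sub>M M)"
proof -
  define r where "r n i = max 0 (min T (real_of_int i / real (Suc n)))" for n i
  have r_in: "r n i \<in> {0..T}" for n i using T by (auto simp: r_def)
  have [measurable]: "(\<lambda>t. t) \<in> borel_measurable (lebesgue_on {0..T})"
    by (rule continuous_imp_measurable_on_sets_lebesgue) (auto intro: continuous_intros)
  have approx: "(\<lambda>x. g (r n \<lfloor>fst x * real (Suc n)\<rfloor>) (snd x)) \<in> borel_measurable (lebesgue_on {0..T} \<Otimes>\<^sub>M M)" for n
  proof (rule measurable_compose_countable[where f = "\<lambda>i x. g (r n i) (snd x)" and g = "\<lambda>x. \<lfloor>fst x * real (Suc n)\<rfloor>"])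
    show "(\<lambda>x. g (r n i) (snd x)) \<in> borel_measurable (lebesgue_on {0..T} \<Otimes>\<^sub>M M)" for i
      using meas[OF r_in] by measurable
  qed measurable
  show ?thesis
  proof (rule borel_measurable_LIMSEQ_real)
    show "(\<lambda>x. g (r n \<lfloor>fst x * real (Suc n)\<rfloor>) (snd x)) \<in> borel_measurable (lebesgue_on {0..T} \<Otimes>\<^sub>M M)" for n
      by (rule approx)
    fix x assume "x \<in> space (lebesgue_on {0..T} \<Otimes>\<^sub>M M)"
    then obtain t \<omega> where x: "x = (t, \<omega>)" "t \<in> {0..T}" "\<omega> \<in> space M"
      by (auto simp: space_pair_measure)
    have lim: "(\<lambda>n. r n \<lfloor>t * real (Suc n)\<rfloor>) \<longlonglongrightarrow> t"
    proof (rule tendsto_sandwich)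
      show "(\<lambda>n. t - 1 / real (Suc n)) \<longlonglongrightarrow> t"
        using tendsto_diff[OF tendsto_const LIMSEQ_inverse_real_of_nat, of t] by (simp add: inverse_eq_divide)
      show "\<forall>\<^sub>F n in sequentially. t - 1 / real (Suc n) \<le> r n \<lfloor>t * real (Suc n)\<rfloor>"
      proof (rule always_eventually, rule allI)
        fix n
        have "t * real (Suc n) - 1 \<le> real_of_int \<lfloor>t * real (Suc n)\<rfloor>" by linarith
        then have "(t * real (Suc n) - 1) / real (Suc n) \<le> real_of_int \<lfloor>t * real (Suc n)\<rfloor> / real (Suc n)"
          by (rule divide_right_mono) simp
        then have "t - 1 / real (Suc n) \<le> real_of_int \<lfloor>t * real (Suc n)\<rfloor> / real (Suc n)"
          by (simp add: diff_divide_distrib)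
        moreover have "t - 1 / real (Suc n) \<le> T"
          using x(2) by (auto intro: order_trans[of _ t])
        ultimately show "t - 1 / real (Suc n) \<le> r n \<lfloor>t * real (Suc n)\<rfloor>"
          unfolding r_def by linarith
      qed
      show "\<forall>\<^sub>F n in sequentially. r n \<lfloor>t * real (Suc n)\<rfloor> \<le> t"
      proof (rule always_eventually, rule allI)
        fix n
        have "real_of_int \<lfloor>t * real (Suc n)\<rfloor> / real (Suc n) \<le> (t * real (Suc n)) / real (Suc n)"
          by (rule divide_right_mono) auto
        then show "r n \<lfloor>t * real (Suc n)\<rfloor> \<le> t"
          using x(2) unfolding r_def by auto
      qed
    qed simp
    have "(\<lambda>n. g (r n \<lfloor>t * real (Suc n)\<rfloor>) \<omega>) \<longlonglongrightarrow> g t \<omega>"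
      using continuous_on_tendsto_compose[OF cont[OF x(3)] lim x(2)] r_in by simp
    then show "(\<lambda>n. g (r n \<lfloor>fst x * real (Suc n)\<rfloor>) (snd x)) \<longlonglongrightarrow> (case x of (t, \<omega>) \<Rightarrow> g t \<omega>)"
      by (simp add: x(1))
  qed
qed

section \<open>The response of a linear equation to its input\<close>

text \<open>The role of \<open>g\<close> will be played by \<open>G(t) e\<^bsup>A(t)\<^esup>\<close>, altered on a null set so that all paths, and not
  only almost all, are continuous. Measures on the time axis are taken on the completed interval
  \<open>lebesgue_on {0..T}\<close>, since controls are Lebesgue measurable functions.\<close>

locale linear_response = prob_space M for M :: "'a measure" +
  fixes T :: real and g :: "real \<Rightarrow> 'a \<Rightarrow> real"
  assumes T_pos: "0 < T"
    and g_cont: "\<And>\<omega>. \<omega> \<in> space M \<Longrightarrow> continuous_on {0..T} (\<lambda>t. g t \<omega>)"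
    and g_pos: "\<And>\<omega> t. \<omega> \<in> space M \<Longrightarrow> t \<in> {0..T} \<Longrightarrow> 0 < g t \<omega>"
    and g_meas: "\<And>t. t \<in> {0..T} \<Longrightarrow> g t \<in> borel_measurable M"

begin

abbreviation "\<Lambda> \<equiv> lebesgue_on {0..T}"

text \<open>The solution of \<open>dX = (a X + f) dt + X dW\<close> with \<open>X(0) = 0\<close>, by variation of constants.\<close>

definition response :: "(real \<Rightarrow> 'a \<Rightarrow> real) \<Rightarrow> real \<Rightarrow> 'a \<Rightarrow> real" where
  "response f t \<omega> = g t \<omega> * (\<integral>s. f s \<omega> / g s \<omega> \<partial>lebesgue_on {0..t})"

lemma finite_\<Lambda>: "finite_measure \<Lambda>"
  by (rule finite_measure_lebesgue_on) (metis cbox_interval lmeasurable_cbox)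

lemma sigma_finite_\<Lambda>: "sigma_finite_measure \<Lambda>"
  using finite_\<Lambda> by (rule finite_measure.sigma_finite_measure)

lemma pair_sigma_finite_\<Lambda>: "pair_sigma_finite \<Lambda> M"
  by (intro pair_sigma_finite.intro sigma_finite_\<Lambda>) unfold_locales

lemma time_measurable [measurable]: "(\<lambda>t. t) \<in> borel_measurable \<Lambda>"
  by (rule continuous_imp_measurable_on_sets_lebesgue) (auto intro: continuous_intros)

lemma g_joint [measurable]: "(\<lambda>(t, \<omega>). g t \<omega>) \<in> borel_measurable (\<Lambda> \<Otimes>\<^sub>M M)"
  using g_cont g_meas T_pos by (intro borel_measurable_continuous_process) auto

lemma g_path_meas: "\<omega> \<in> space M \<Longrightarrow> (\<lambda>t. g t \<omega>) \<in> borel_measurable \<Lambda>"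
  using g_cont by (intro continuous_imp_measurable_on_sets_lebesgue) auto

lemma g_bounds:
  assumes "\<omega> \<in> space M"
  obtains c C where "0 < c" "0 < C" "\<And>t. t \<in> {0..T} \<Longrightarrow> c \<le> g t \<omega> \<and> g t \<omega> \<le> C"
proof -
  have ne: "{0..T} \<noteq> {}" using T_pos by auto
  obtain t1 where t1: "t1 \<in> {0..T}" "\<And>t. t \<in> {0..T} \<Longrightarrow> g t1 \<omega> \<le> g t \<omega>"
    using continuous_attains_inf[OF compact_Icc ne g_cont[OF assms]] by auto
  obtain t2 where t2: "t2 \<in> {0..T}" "\<And>t. t \<in> {0..T} \<Longrightarrow> g t \<omega> \<le> g t2 \<omega>"
    using continuous_attains_sup[OF compact_Icc ne g_cont[OF assms]] by auto
  show thesis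
    using that[of "g t1 \<omega>" "g t2 \<omega>"] g_pos[OF assms] t1 t2 by auto
qed

lemma integrable_div_g:
  assumes "\<omega> \<in> space M" "integrable \<Lambda> h"
  shows "integrable \<Lambda> (\<lambda>s. h s / g s \<omega>)"
proof -
  obtain c C where c: "0 < c" "\<And>t. t \<in> {0..T} \<Longrightarrow> c \<le> g t \<omega> \<and> g t \<omega> \<le> C"
    using g_bounds[OF assms(1)] by metis
  note [measurable] = g_path_meas[OF assms(1)] borel_measurable_integrable[OF assms(2)]
  show ?thesis
  proof (rule Bochner_Integration.integrable_bound)
    show "integrable \<Lambda> (\<lambda>s. \<bar>h s\<bar> / c)" using assms(2) by auto
    show "AE s in \<Lambda>. norm (h s / g s \<omega>) \<le> norm (\<bar>h s\<bar> / c)"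
    proof (rule AE_I2)
      fix s assume "s \<in> space \<Lambda>"
      then have "c \<le> g s \<omega>" using c(2) by simp
      then show "norm (h s / g s \<omega>) \<le> norm (\<bar>h s\<bar> / c)"
        using c(1) by (simp add: frac_le)
    qed
  qed measurable
qed

text \<open>Moving the upper limit into the integrand leaves a single measure on the time axis, so that
  Fubini's theorem applies.\<close>

lemma integral_up_to:
  fixes h :: "real \<Rightarrow> real"
  assumes "t \<in> {0..T}"
  shows "(\<integral>s. h s \<partial>lebesgue_on {0..t}) = (\<integral>s. indicator {0..t} s * h s \<partial>\<Lambda>)"
proof -
  have "(\<integral>s. h s \<partial>lebesgue_on {0..t}) = (\<integral>s. indicator {0..t} s * h s \<partial>lebesgue)"
    by (subst integral_restrict_space) auto
  also have "\<dots> = (\<integral>s. indicator {0..T} s *\<^sub>R (indicator {0..t} s * h s) \<partial>lebesgue)"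
    using assms by (intro Bochner_Integration.integral_cong) (auto simp: indicator_def)
  also have "\<dots> = (\<integral>s. indicator {0..t} s * h s \<partial>\<Lambda>)"
    by (subst integral_restrict_space) auto
  finally show ?thesis .
qed

lemma integrable_indicator_Icc:
  fixes h :: "real \<Rightarrow> real"
  assumes "integrable \<Lambda> h"
  shows "integrable \<Lambda> (\<lambda>s. indicator {0..t} s * h s)"
proof (rule Bochner_Integration.integrable_bound[OF assms])
  show "(\<lambda>s. indicator {0..t} s * h s) \<in> borel_measurable \<Lambda>"
    using assms by measurable
qed (auto simp: indicator_def)

lemma response_alt:
  assumes "t \<in> {0..T}"
  shows "response f t \<omega> = g t \<omega> * (\<integral>s. indicator {0..t} s * (f s \<omega> / g s \<omega>) \<partial>\<Lambda>)"
  unfolding response_def integral_up_to[OF assms] ..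

lemma response_linear:
  assumes "\<omega> \<in> space M" "t \<in> {0..T}" "integrable \<Lambda> (\<lambda>s. f1 s \<omega>)" "integrable \<Lambda> (\<lambda>s. f2 s \<omega>)"
  shows "response (\<lambda>s \<omega>. a * f1 s \<omega> + b * f2 s \<omega>) t \<omega> = a * response f1 t \<omega> + b * response f2 t \<omega>"
proof -
  let ?h = "\<lambda>f s. indicator {0..t} s * (f s \<omega> / g s \<omega>)"
  have int: "integrable \<Lambda> (?h f1)" "integrable \<Lambda> (?h f2)"
    using assms by (auto intro!: integrable_indicator_Icc integrable_div_g)
  have "(\<integral>s. ?h (\<lambda>s \<omega>. a * f1 s \<omega> + b * f2 s \<omega>) s \<partial>\<Lambda>) = (\<integral>s. a * ?h f1 s + b * ?h f2 s \<partial>\<Lambda>)"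
    by (intro Bochner_Integration.integral_cong) (auto simp: field_simps add_divide_distrib)
  also have "\<dots> = a * (\<integral>s. ?h f1 s \<partial>\<Lambda>) + b * (\<integral>s. ?h f2 s \<partial>\<Lambda>)"
    using int by (simp only: Bochner_Integration.integral_add integrable_mult_right integral_mult_right_zero)
  finally show ?thesis
    unfolding response_alt[OF assms(2)] by (simp only: distrib_left mult.left_commute)
qed

text \<open>The constant depends on the path, but neither on the input nor on the time: it is the ratio of the
  maximum and the minimum of \<open>g\<close> along the path.\<close>

lemma response_bound:
  assumes "\<omega> \<in> space M"
  obtains K where "0 < K" "\<And>f t. t \<in> {0..T} \<Longrightarrow> integrable \<Lambda> (\<lambda>s. f s \<omega>) \<Longrightarrow>
    \<bar>response f t \<omega>\<bar> \<le> K * (\<integral>s. \<bar>f s \<omega>\<bar> \<partial>\<Lambda>)"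
proof -
  obtain c C where c: "0 < c" "0 < C" "\<And>t. t \<in> {0..T} \<Longrightarrow> c \<le> g t \<omega> \<and> g t \<omega> \<le> C"
    using g_bounds[OF assms(1)] by metis
  have "\<bar>response f t \<omega>\<bar> \<le> C / c * (\<integral>s. \<bar>f s \<omega>\<bar> \<partial>\<Lambda>)"
    if t: "t \<in> {0..T}" and f: "integrable \<Lambda> (\<lambda>s. f s \<omega>)" for f t
  proof -
    have "\<bar>\<integral>s. indicator {0..t} s * (f s \<omega> / g s \<omega>) \<partial>\<Lambda>\<bar> \<le> (\<integral>s. \<bar>f s \<omega>\<bar> / c \<partial>\<Lambda>)"
    proof (rule order_trans[OF integral_abs_bound], rule integral_mono)
      show "integrable \<Lambda> (\<lambda>s. \<bar>indicator {0..t} s * (f s \<omega> / g s \<omega>)\<bar>)"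
        using f assms by (intro integrable_abs integrable_indicator_Icc integrable_div_g)
      show "integrable \<Lambda> (\<lambda>s. \<bar>f s \<omega>\<bar> / c)" using f by auto
      fix s assume "s \<in> space \<Lambda>"
      then have "c \<le> g s \<omega>" using c(3) by simp
      then show "\<bar>indicator {0..t} s * (f s \<omega> / g s \<omega>)\<bar> \<le> \<bar>f s \<omega>\<bar> / c"
        using c(1) by (auto simp: frac_le indicator_def)
    qed
    then have "\<bar>g t \<omega>\<bar> * \<bar>\<integral>s. indicator {0..t} s * (f s \<omega> / g s \<omega>) \<partial>\<Lambda>\<bar> \<le> C * (\<integral>s. \<bar>f s \<omega>\<bar> / c \<partial>\<Lambda>)"
      using c(1,2) c(3)[OF t] by (intro mult_mono) auto
    then show ?thesis using t by (simp add: response_alt abs_mult)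
  qed
  then show thesis using that[of "C / c"] c by auto
qed

lemma response_continuous:
  assumes "\<omega> \<in> space M" "integrable \<Lambda> (\<lambda>s. f s \<omega>)"
  shows "continuous_on {0..T} (\<lambda>t. response f t \<omega>)"
  unfolding response_def
  by (intro continuous_on_mult g_cont indefinite_integral_continuous_real integrable_div_g assms)

text \<open>By continuity the response vanishes at all times, not only at almost all of them, and then so does the
  primitive of \<open>h / g\<close>.\<close>

lemma response_eq_0_imp_AE_0:
  assumes \<omega>: "\<omega> \<in> space M" and h: "integrable \<Lambda> h"
    and zero: "AE t in \<Lambda>. response (\<lambda>s _. h s) t \<omega> = 0"
  shows "AE t in \<Lambda>. h t = 0"
proof -
  have cont: "continuous_on {0..T} (\<lambda>t. response (\<lambda>s _. h s) t \<omega>)"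
    using \<omega> h by (intro response_continuous) auto
  have all: "response (\<lambda>s _. h s) t \<omega> = 0" if t: "t \<in> {0..T}" for t
  proof (rule ccontr)
    assume "response (\<lambda>s _. h s) t \<omega> \<noteq> 0"
    then obtain a b where ab: "a < b" "{a<..<b} \<subseteq> {0..T}"
        "\<And>s. s \<in> {a<..<b} \<Longrightarrow> response (\<lambda>s _. h s) s \<omega> \<in> - {0}"
      using continuous_Icc_open_interval[OF T_pos cont t, of "- {0}"] by auto
    have "AE s in lebesgue. s \<in> {0..T} \<longrightarrow> response (\<lambda>s _. h s) s \<omega> = 0"
      using zero by (simp add: AE_restrict_space_iff)
    then have "AE s in lebesgue. s \<notin> {a<..<b}"
      by eventually_elim (use ab(2,3) in blast)
    then have "{a<..<b} \<in> null_sets lebesgue"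
      by (subst (asm) AE_iff_null_sets[symmetric]) (auto intro: borel_open)
    then show False using ab(1)
      by (auto simp: null_sets_def)
  qed
  have "AE t in \<Lambda>. h t / g t \<omega> = 0"
  proof (rule zero_primitive_imp_AE_zero)
    show "integrable \<Lambda> (\<lambda>t. h t / g t \<omega>)" by (rule integrable_div_g[OF \<omega> h])
    show "(\<integral>s. h s / g s \<omega> \<partial>lebesgue_on {0..t}) = 0" if "t \<in> {0..T}" for t
      using all[OF that] g_pos[OF \<omega> that] by (simp add: response_def)
  qed
  then have "AE t in \<Lambda>. t \<in> {0..T} \<longrightarrow> h t / g t \<omega> = 0" by eventually_elim simp
  then show ?thesis
    using AE_space[of \<Lambda>] by eventually_elim (use g_pos[OF \<omega>] in force)
qed

lemma response_joint:
  assumes [measurable]: "(\<lambda>(t, \<omega>). f t \<omega>) \<in> borel_measurable (\<Lambda> \<Otimes>\<^sub>M M)"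
  shows "(\<lambda>(t, \<omega>). response f t \<omega>) \<in> borel_measurable (\<Lambda> \<Otimes>\<^sub>M M)"
proof -
  interpret L: sigma_finite_measure \<Lambda> by (rule sigma_finite_\<Lambda>)
  have "(\<lambda>x. g (fst x) (snd x) * (\<integral>s. (if 0 \<le> s \<and> s \<le> fst x then f s (snd x) / g s (snd x) else 0) \<partial>\<Lambda>))
      \<in> borel_measurable (\<Lambda> \<Otimes>\<^sub>M M)"
    by measurable
  then show ?thesis
    by (rule measurable_cong[THEN iffD1, rotated])
       (auto simp: space_pair_measure response_alt indicator_def intro!: Bochner_Integration.integral_cong)
qed

lemma response_meas:
  assumes "(\<lambda>(t, \<omega>). f t \<omega>) \<in> borel_measurable (\<Lambda> \<Otimes>\<^sub>M M)" "t \<in> {0..T}"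
  shows "(\<lambda>\<omega>. response f t \<omega>) \<in> borel_measurable M"
  using measurable_compose[OF measurable_Pair1' response_joint[OF assms(1)]] assms(2) by simp

text \<open>The weight \<open>m\<close> dominates the \<open>L\<^sup>p\<close> norm of \<open>z s\<close>, so that the first moments of \<open>z\<close> are at most \<open>2 m\<close>,
  and Tonelli's theorem makes almost every path integrable.\<close>

lemma moment_imp_paths_integrable:
  fixes z :: "real \<Rightarrow> 'a \<Rightarrow> real" and m :: "real \<Rightarrow> real"
  assumes z: "(\<lambda>(t, \<omega>). z t \<omega>) \<in> borel_measurable (\<Lambda> \<Otimes>\<^sub>M M)"
    and p: "1 \<le> p"
    and m: "integrable \<Lambda> m" "\<And>s. s \<in> {0..T} \<Longrightarrow> 1 \<le> m s"
    and z_m: "\<And>s. s \<in> {0..T} \<Longrightarrow> (\<integral>\<^sup>+ \<omega>. ennreal ((\<bar>z s \<omega>\<bar> / m s) powr p) \<partial>M) \<le> 1"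
  shows "AE \<omega> in M. integrable \<Lambda> (\<lambda>t. z t \<omega>)"
proof -
  interpret L: sigma_finite_measure \<Lambda> by (rule sigma_finite_\<Lambda>)
  interpret P: pair_sigma_finite \<Lambda> M by (rule pair_sigma_finite_\<Lambda>)
  note [measurable] = z
  have z_slice: "(\<lambda>\<omega>. z s \<omega>) \<in> borel_measurable M" if "s \<in> {0..T}" for s
    using measurable_compose[OF measurable_Pair1' z] that by simp
  have z_path_meas: "(\<lambda>s. z s \<omega>) \<in> borel_measurable \<Lambda>" if "\<omega> \<in> space M" for \<omega>
    using measurable_compose[OF measurable_Pair2' z] that by simp
  have meas: "(\<lambda>x. ennreal \<bar>z (fst x) (snd x)\<bar>) \<in> borel_measurable (\<Lambda> \<Otimes>\<^sub>M M)" by measurable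
  have slice: "(\<integral>\<^sup>+ \<omega>. ennreal \<bar>z s \<omega>\<bar> \<partial>M) \<le> ennreal (2 * m s)" if s: "s \<in> {0..T}" for s
  proof -
    note [measurable] = z_slice[OF s]
    have m_pos: "m s > 0" using m(2)[OF s] by simp
    have "(\<integral>\<^sup>+ \<omega>. ennreal \<bar>z s \<omega>\<bar> \<partial>M)
        \<le> (\<integral>\<^sup>+ \<omega>. ennreal (m s) * (1 + ennreal ((\<bar>z s \<omega>\<bar> / m s) powr p)) \<partial>M)"
    proof (rule nn_integral_mono)
      fix \<omega>
      have "\<bar>z s \<omega>\<bar> / m s \<le> 1 + (\<bar>z s \<omega>\<bar> / m s) powr p"
        using le_truncate_powr[of "\<bar>z s \<omega>\<bar> / m s" p 1] p m_pos by simp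
      then have "\<bar>z s \<omega>\<bar> \<le> m s * (1 + (\<bar>z s \<omega>\<bar> / m s) powr p)"
        using m_pos by (simp add: pos_divide_le_eq mult.commute)
      then have "ennreal \<bar>z s \<omega>\<bar> \<le> ennreal (m s * (1 + (\<bar>z s \<omega>\<bar> / m s) powr p))"
        by (rule ennreal_leI)
      then show "ennreal \<bar>z s \<omega>\<bar> \<le> ennreal (m s) * (1 + ennreal ((\<bar>z s \<omega>\<bar> / m s) powr p))"
        using m_pos by (simp add: ennreal_mult)
    qed
    also have "\<dots> = ennreal (m s) * (1 + (\<integral>\<^sup>+ \<omega>. ennreal ((\<bar>z s \<omega>\<bar> / m s) powr p) \<partial>M))"
      by (simp add: nn_integral_cmult nn_integral_add emeasure_space_1)
    also have "\<dots> \<le> ennreal (m s) * (1 + 1)"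
      by (intro mult_left_mono add_left_mono z_m s) auto
    also have "\<dots> = ennreal (2 * m s)"
      using m_pos by (simp add: ennreal_mult mult.commute)
    finally show ?thesis .
  qed
  have "(\<integral>\<^sup>+ \<omega>. (\<integral>\<^sup>+ s. ennreal \<bar>z s \<omega>\<bar> \<partial>\<Lambda>) \<partial>M) = (\<integral>\<^sup>+ s. (\<integral>\<^sup>+ \<omega>. ennreal \<bar>z s \<omega>\<bar> \<partial>M) \<partial>\<Lambda>)"
    using P.nn_integral_snd[OF meas] nn_integral_fst[OF meas] by simp
  also have "\<dots> \<le> (\<integral>\<^sup>+ s. ennreal (2 * m s) \<partial>\<Lambda>)"
    by (intro nn_integral_mono slice) simp
  also have "\<dots> = ennreal (\<integral>s. 2 * m s \<partial>\<Lambda>)"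
    using m by (intro nn_integral_eq_integral AE_I2) (auto intro: order_trans[OF zero_le_one])
  finally have "(\<integral>\<^sup>+ \<omega>. (\<integral>\<^sup>+ s. ennreal \<bar>z s \<omega>\<bar> \<partial>\<Lambda>) \<partial>M) \<noteq> \<infinity>"
    by (auto simp: top_unique)
  then have "AE \<omega> in M. (\<integral>\<^sup>+ s. ennreal \<bar>z s \<omega>\<bar> \<partial>\<Lambda>) \<noteq> \<infinity>"
    by (intro nn_integral_PInf_AE L.borel_measurable_nn_integral) measurable
  then show ?thesis
    using AE_space
  proof eventually_elim
    case (elim \<omega>)
    then show ?case
      using z_path_meas[of \<omega>] by (intro integrableI_bounded) (auto simp: less_top)
  qed
qed

end

section \<open>Convex tracking costs\<close>

lemma ennreal_average_self: "(x + x) / 2 = (x :: ennreal)"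
  using ennreal_mult_divide_eq[of 2 x] by (simp flip: mult_2_right)

locale tracking_problem = linear_response M T g for M :: "'a measure" and T and g +
  fixes z :: "real \<Rightarrow> 'a \<Rightarrow> real" and F :: "real \<Rightarrow> real \<Rightarrow> real"
  assumes z_meas: "(\<lambda>(t, \<omega>). z t \<omega>) \<in> borel_measurable (\<Lambda> \<Otimes>\<^sub>M M)"
    and z_path: "\<And>\<omega>. \<omega> \<in> space M \<Longrightarrow> integrable \<Lambda> (\<lambda>t. z t \<omega>)"
    and F_meas: "(\<lambda>(t, x). F t x) \<in> borel_measurable (restrict_space borel ({0..T} \<times> UNIV))"
    and F_nonneg: "\<And>t x. t \<in> {0..T} \<Longrightarrow> F t x \<ge> 0"
    and F_cont: "\<And>t. t \<in> {0..T} \<Longrightarrow> continuous_on UNIV (F t)"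
    and F_convex: "\<And>t. t \<in> {0..T} \<Longrightarrow> strictly_convex (F t)"

begin

definition \<xi> :: "(real \<Rightarrow> real) \<Rightarrow> real \<Rightarrow> 'a \<Rightarrow> real" where
  "\<xi> u = response (\<lambda>s \<omega>. z s \<omega> - u s)"

definition J :: "(real \<Rightarrow> real) \<Rightarrow> ennreal" where
  "J u = (\<integral>\<^sup>+ \<omega>. (\<integral>\<^sup>+ t. ennreal (F t (\<xi> u t \<omega>)) \<partial>\<Lambda>) \<partial>M)"

definition running_cost :: "(real \<Rightarrow> real) \<Rightarrow> 'a \<times> real \<Rightarrow> real" where
  "running_cost u = (\<lambda>(\<omega>, t). F t (\<xi> u t \<omega>))"

lemma control_error_joint:
  assumes "integrable \<Lambda> u"
  shows "(\<lambda>(t, \<omega>). z t \<omega> - u t) \<in> borel_measurable (\<Lambda> \<Otimes>\<^sub>M M)"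
proof -
  have [measurable]: "u \<in> borel_measurable \<Lambda>" using assms by auto
  note [measurable] = z_meas
  show ?thesis by measurable
qed

lemma \<xi>_joint:
  assumes "integrable \<Lambda> u"
  shows "(\<lambda>(t, \<omega>). \<xi> u t \<omega>) \<in> borel_measurable (\<Lambda> \<Otimes>\<^sub>M M)"
  unfolding \<xi>_def by (rule response_joint[OF control_error_joint[OF assms]])

lemma running_cost_meas:
  assumes "integrable \<Lambda> u"
  shows "running_cost u \<in> borel_measurable (M \<Otimes>\<^sub>M \<Lambda>)"
proof -
  note [measurable] = \<xi>_joint[OF assms]
  have "(\<lambda>x. (fst x, \<xi> u (fst x) (snd x))) \<in> \<Lambda> \<Otimes>\<^sub>M M \<rightarrow>\<^sub>M restrict_space borel ({0..T} \<times> UNIV)"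
  proof (rule measurable_restrict_space2)
    show "(\<lambda>x. (fst x, \<xi> u (fst x) (snd x))) \<in> borel_measurable (\<Lambda> \<Otimes>\<^sub>M M)"
      unfolding borel_prod[symmetric] by measurable
  qed (auto simp: space_pair_measure)
  from measurable_compose[OF this F_meas]
  have "(\<lambda>x. F (fst x) (\<xi> u (fst x) (snd x))) \<in> borel_measurable (\<Lambda> \<Otimes>\<^sub>M M)" by simp
  from measurable_compose[OF measurable_pair_swap' this]
  show ?thesis by (simp add: running_cost_def split_beta)
qed

text \<open>Integrating over the product once, instead of twice in succession, reduces Fatou's lemma and
  the comparison of costs to one application each.\<close>

lemma J_eq_product_integral:
  assumes "integrable \<Lambda> u"
  shows "J u = (\<integral>\<^sup>+ x. ennreal (running_cost u x) \<partial>(M \<Otimes>\<^sub>M \<Lambda>))"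
proof -
  interpret L: sigma_finite_measure \<Lambda> by (rule sigma_finite_\<Lambda>)
  have "(\<lambda>x. ennreal (running_cost u x)) \<in> borel_measurable (M \<Otimes>\<^sub>M \<Lambda>)"
    using running_cost_meas[OF assms] by measurable
  from L.nn_integral_fst[OF this] show ?thesis
    by (simp add: J_def running_cost_def)
qed

lemma running_cost_nonneg: "x \<in> space (M \<Otimes>\<^sub>M \<Lambda>) \<Longrightarrow> running_cost u x \<ge> 0"
  using F_nonneg by (auto simp: running_cost_def space_pair_measure)

lemma error_path_integrable:
  "\<omega> \<in> space M \<Longrightarrow> integrable \<Lambda> u \<Longrightarrow> integrable \<Lambda> (\<lambda>s. z s \<omega> - u s)"
  using z_path by auto

lemma \<xi>_midpoint:
  assumes "\<omega> \<in> space M" "t \<in> {0..T}" "integrable \<Lambda> u" "integrable \<Lambda> v"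
  shows "\<xi> (\<lambda>s. (u s + v s) / 2) t \<omega> = (\<xi> u t \<omega> + \<xi> v t \<omega>) / 2"
proof -
  have "(\<lambda>s \<omega>. z s \<omega> - (u s + v s) / 2) = (\<lambda>s \<omega>. 1/2 * (z s \<omega> - u s) + 1/2 * (z s \<omega> - v s))"
    by (auto simp: fun_eq_iff field_simps)
  then show ?thesis
    unfolding \<xi>_def using response_linear[OF assms(1,2), of "\<lambda>s \<omega>. z s \<omega> - u s" "\<lambda>s \<omega>. z s \<omega> - v s" "1/2" "1/2"]
      error_path_integrable assms by (simp add: add_divide_distrib)
qed

lemma \<xi>_diff:
  assumes "\<omega> \<in> space M" "t \<in> {0..T}" "integrable \<Lambda> u" "integrable \<Lambda> v"
  shows "\<xi> v t \<omega> - \<xi> u t \<omega> = response (\<lambda>s _. u s - v s) t \<omega>"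
proof -
  have "(\<lambda>s _. u s - v s) = (\<lambda>s \<omega>. 1 * (z s \<omega> - v s) + (- 1) * (z s \<omega> - u s))"
    by (auto simp: fun_eq_iff)
  then show ?thesis
    unfolding \<xi>_def using response_linear[OF assms(1,2), of "\<lambda>s \<omega>. z s \<omega> - v s" "\<lambda>s \<omega>. z s \<omega> - u s" "1" "-1"]
      error_path_integrable assms by simp
qed

lemma running_cost_midpoint:
  assumes "x \<in> space (M \<Otimes>\<^sub>M \<Lambda>)" "integrable \<Lambda> u" "integrable \<Lambda> v"
  defines "w \<equiv> \<lambda>s. (u s + v s) / 2"
  shows "running_cost w x \<le> (running_cost u x + running_cost v x) / 2"
    and "\<xi> u (snd x) (fst x) \<noteq> \<xi> v (snd x) (fst x) \<Longrightarrow>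
      running_cost w x < (running_cost u x + running_cost v x) / 2"
proof -
  obtain \<omega> t where x: "x = (\<omega>, t)" "\<omega> \<in> space M" "t \<in> {0..T}"
    using assms(1) by (auto simp: space_pair_measure)
  have w: "\<xi> w t \<omega> = (\<xi> u t \<omega> + \<xi> v t \<omega>) / 2"
    unfolding w_def using x assms by (intro \<xi>_midpoint) auto
  have strict: "running_cost w x < (running_cost u x + running_cost v x) / 2"
    if ne: "\<xi> u t \<omega> \<noteq> \<xi> v t \<omega>"
  proof -
    have "\<forall>c. 0 < c \<and> c < 1 \<longrightarrow> F t ((1 - c) * \<xi> u t \<omega> + c * \<xi> v t \<omega>) < (1 - c) * F t (\<xi> u t \<omega>) + c * F t (\<xi> v t \<omega>)"
      using F_convex[OF x(3)] ne unfolding strictly_convex_def by blast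
    from this[rule_format, of "1/2"] show ?thesis
      by (simp add: running_cost_def x w add_divide_distrib)
  qed
  then show "\<xi> u (snd x) (fst x) \<noteq> \<xi> v (snd x) (fst x) \<Longrightarrow>
      running_cost w x < (running_cost u x + running_cost v x) / 2"
    by (simp add: x)
  show "running_cost w x \<le> (running_cost u x + running_cost v x) / 2"
    using strict by (cases "\<xi> u t \<omega> = \<xi> v t \<omega>") (auto simp: running_cost_def x w)
qed

lemma nn_integral_average:
  assumes "integrable \<Lambda> u" "integrable \<Lambda> v"
  shows "(\<integral>\<^sup>+ x. ennreal ((running_cost u x + running_cost v x) / 2) \<partial>(M \<Otimes>\<^sub>M \<Lambda>)) = (J u + J v) / 2"
proof -
  note [measurable] = running_cost_meas[OF assms(1)] running_cost_meas[OF assms(2)]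
  have "(\<integral>\<^sup>+ x. ennreal ((running_cost u x + running_cost v x) / 2) \<partial>(M \<Otimes>\<^sub>M \<Lambda>))
      = (\<integral>\<^sup>+ x. (ennreal (running_cost u x) + ennreal (running_cost v x)) / 2 \<partial>(M \<Otimes>\<^sub>M \<Lambda>))"
    using running_cost_nonneg
    by (intro nn_integral_cong) (simp add: ennreal_plus[symmetric] ennreal_divide_numeral del: ennreal_plus)
  also have "\<dots> = (\<integral>\<^sup>+ x. ennreal (running_cost u x) + ennreal (running_cost v x) \<partial>(M \<Otimes>\<^sub>M \<Lambda>)) / 2"
    by (intro nn_integral_divide) measurable
  also have "\<dots> = (J u + J v) / 2"
    by (subst nn_integral_add) (simp_all add: J_eq_product_integral assms)
  finally show ?thesis .
qed

lemma J_midpoint: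
  assumes "integrable \<Lambda> u" "integrable \<Lambda> v"
  shows "J (\<lambda>s. (u s + v s) / 2) \<le> (J u + J v) / 2"
proof -
  have "integrable \<Lambda> (\<lambda>s. (u s + v s) / 2)" using assms by auto
  then show ?thesis
    unfolding nn_integral_average[OF assms, symmetric]
    using running_cost_midpoint(1)[OF _ assms]
    by (subst J_eq_product_integral) (auto intro!: nn_integral_mono ennreal_leI)
qed

lemma J_midpoint_max:
  assumes "integrable \<Lambda> u" "integrable \<Lambda> v"
  shows "J (\<lambda>s. (u s + v s) / 2) \<le> max (J u) (J v)"
proof -
  have "(J u + J v) / 2 \<le> (max (J u) (J v) + max (J u) (J v)) / 2"
    by (intro divide_right_mono_ennreal add_mono) auto
  also have "\<dots> = max (J u) (J v)"
    by (rule ennreal_average_self)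
  finally show ?thesis using J_midpoint[OF assms] by simp
qed

text \<open>Convergence in \<open>L\<^sup>1\<close> of the controls gives pointwise convergence of the states, by
  \<open>response_bound\<close>, and the running costs are nonnegative, so Fatou's lemma applies.\<close>

lemma J_lower_semicontinuous:
  assumes u: "\<And>n. integrable \<Lambda> (u n)" and v: "integrable \<Lambda> v"
    and conv: "(\<lambda>n. \<integral>s. \<bar>u n s - v s\<bar> \<partial>\<Lambda>) \<longlonglongrightarrow> 0"
    and J: "(\<lambda>n. J (u n)) \<longlonglongrightarrow> l"
  shows "J v \<le> l"
proof -
  have pointwise: "(\<lambda>n. ennreal (running_cost (u n) x)) \<longlonglongrightarrow> ennreal (running_cost v x)"
    if x: "x \<in> space (M \<Otimes>\<^sub>M \<Lambda>)" for x
  proof -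
    obtain \<omega> t where x: "x = (\<omega>, t)" "\<omega> \<in> space M" "t \<in> {0..T}"
      using x by (auto simp: space_pair_measure)
    obtain K where K: "0 < K" "\<And>f t. t \<in> {0..T} \<Longrightarrow> integrable \<Lambda> (\<lambda>s. f s \<omega>) \<Longrightarrow>
        \<bar>response f t \<omega>\<bar> \<le> K * (\<integral>s. \<bar>f s \<omega>\<bar> \<partial>\<Lambda>)"
      using response_bound[OF x(2)] by metis
    have "(\<lambda>n. \<xi> v t \<omega> - \<xi> (u n) t \<omega>) \<longlonglongrightarrow> 0"
    proof (rule Lim_null_comparison)
      show "\<forall>\<^sub>F n in sequentially. norm (\<xi> v t \<omega> - \<xi> (u n) t \<omega>) \<le> K * (\<integral>s. \<bar>u n s - v s\<bar> \<partial>\<Lambda>)"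
        using K(2)[OF x(3), of "\<lambda>s _. u n s - v s" for n] u v by (auto simp: \<xi>_diff[OF x(2,3) u v])
      show "(\<lambda>n. K * (\<integral>s. \<bar>u n s - v s\<bar> \<partial>\<Lambda>)) \<longlonglongrightarrow> 0"
        using tendsto_mult_left[OF conv, of K] by simp
    qed
    then have "(\<lambda>n. \<xi> v t \<omega> - (\<xi> v t \<omega> - \<xi> (u n) t \<omega>)) \<longlonglongrightarrow> \<xi> v t \<omega> - 0"
      by (intro tendsto_diff tendsto_const)
    then have "(\<lambda>n. \<xi> (u n) t \<omega>) \<longlonglongrightarrow> \<xi> v t \<omega>" by simp
    then have "(\<lambda>n. F t (\<xi> (u n) t \<omega>)) \<longlonglongrightarrow> F t (\<xi> v t \<omega>)"
      by (rule continuous_on_tendsto_compose[OF F_cont[OF x(3)]]) auto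
    then show ?thesis by (auto simp: running_cost_def x intro!: tendsto_ennrealI)
  qed
  have meas: "(\<lambda>x. ennreal (running_cost (u n) x)) \<in> borel_measurable (M \<Otimes>\<^sub>M \<Lambda>)" for n
    using running_cost_meas[OF u] by measurable
  have "J v = (\<integral>\<^sup>+ x. liminf (\<lambda>n. ennreal (running_cost (u n) x)) \<partial>(M \<Otimes>\<^sub>M \<Lambda>))"
    unfolding J_eq_product_integral[OF v]
    by (intro nn_integral_cong lim_imp_Liminf[symmetric] pointwise) auto
  also have "\<dots> \<le> liminf (\<lambda>n. \<integral>\<^sup>+ x. ennreal (running_cost (u n) x) \<partial>(M \<Otimes>\<^sub>M \<Lambda>))"
    by (intro nn_integral_liminf meas)
  also have "\<dots> = liminf (\<lambda>n. J (u n))"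
    by (simp add: J_eq_product_integral u)
  also have "\<dots> = l"
    using J by (intro lim_imp_Liminf) auto
  finally show ?thesis .
qed

text \<open>The midpoint \<open>w\<close> of two minimizers costs as much as their average, so the running costs of \<open>w\<close>
  and the averaged running costs agree almost everywhere; by strict convexity the two states then
  agree almost everywhere. One path on which they do so at almost every time suffices to recover the
  controls.\<close>

lemma minimizer_unique:
  assumes u: "integrable \<Lambda> u" and v: "integrable \<Lambda> v"
    and min: "\<And>w. integrable \<Lambda> w \<Longrightarrow> J u \<le> J w" and fin: "J u < \<infinity>" and eq: "J v \<le> J u"
  shows "AE t in \<Lambda>. u t = v t"
proof -
  interpret MP: pair_sigma_finite M \<Lambda>
    by (intro pair_sigma_finite.intro sigma_finite_\<Lambda>) unfold_locales
  define w where "w s = (u s + v s) / 2" for s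
  have w: "integrable \<Lambda> w" unfolding w_def using u v by auto
  let ?P = "M \<Otimes>\<^sub>M \<Lambda>"
  let ?avg = "\<lambda>x. (running_cost u x + running_cost v x) / 2"
  note [measurable] = running_cost_meas[OF u] running_cost_meas[OF v] running_cost_meas[OF w]
  have le: "running_cost w x \<le> ?avg x" if "x \<in> space ?P" for x
    unfolding w_def using running_cost_midpoint(1)[OF that u v] .
  have Juv: "J v = J u" using eq min[OF v] by simp
  have avg: "(\<integral>\<^sup>+ x. ennreal (?avg x) \<partial>?P) = J u"
    unfolding nn_integral_average[OF u v] Juv
    by (rule ennreal_average_self)
  have Jw: "J w = J u"
    using min[OF w] J_midpoint_max[OF u v] Juv unfolding w_def by (simp add: max_def)
  have "(\<integral>\<^sup>+ x. ennreal (?avg x) - ennreal (running_cost w x) \<partial>?P)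
      = (\<integral>\<^sup>+ x. ennreal (?avg x) \<partial>?P) - (\<integral>\<^sup>+ x. ennreal (running_cost w x) \<partial>?P)"
  proof (rule nn_integral_diff)
    show "(\<integral>\<^sup>+ x. ennreal (running_cost w x) \<partial>?P) \<noteq> \<infinity>"
      using Jw fin by (simp add: J_eq_product_integral w)
    show "AE x in ?P. ennreal (running_cost w x) \<le> ennreal (?avg x)"
      by (intro AE_I2 ennreal_leI le)
  qed measurable
  also have "\<dots> = 0"
    using avg Jw fin J_eq_product_integral[OF w] by simp
  finally have "AE x in ?P. ennreal (?avg x) - ennreal (running_cost w x) = 0"
    by (subst (asm) nn_integral_0_iff_AE) measurable
  then have "AE x in ?P. \<xi> u (snd x) (fst x) = \<xi> v (snd x) (fst x)"
    using AE_space
  proof eventually_elim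
    case (elim x)
    then have "ennreal (?avg x) \<le> ennreal (running_cost w x)"
      by (simp add: diff_eq_0_iff_ennreal)
    then have "?avg x \<le> running_cost w x"
      using running_cost_nonneg[OF elim(2)] by (subst (asm) ennreal_le_iff) auto
    then show ?case
      using running_cost_midpoint(2)[OF elim(2) u v] unfolding w_def by fastforce
  qed
  from MP.AE_pair[OF this] have AE2: "AE \<omega> in M. AE t in \<Lambda>. \<xi> u t \<omega> = \<xi> v t \<omega>" by simp
  have "\<exists>\<omega>\<in>space M. AE t in \<Lambda>. \<xi> u t \<omega> = \<xi> v t \<omega>"
  proof (rule ccontr)
    assume "\<not> ?thesis"
    then have "AE \<omega> in M. (AE t in \<Lambda>. \<xi> u t \<omega> = \<xi> v t \<omega>) \<longrightarrow> False"
      by (intro AE_I2) blast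
    with AE2 have "AE \<omega> in M. False" by (rule AE_mp)
    then show False by (simp add: AE_False)
  qed
  then obtain \<omega> where \<omega>: "\<omega> \<in> space M" "AE t in \<Lambda>. \<xi> u t \<omega> = \<xi> v t \<omega>" by blast
  from \<omega>(2) AE_space have "AE t in \<Lambda>. response (\<lambda>s _. u s - v s) t \<omega> = 0"
  proof eventually_elim
    case (elim t)
    then have "t \<in> {0..T}" by simp
    from \<xi>_diff[OF \<omega>(1) this u v] elim(1) show ?case by simp
  qed
  moreover have "integrable \<Lambda> (\<lambda>s. u s - v s)"
    using u v by (rule Bochner_Integration.integrable_diff)
  ultimately have "AE t in \<Lambda>. u t - v t = 0"
    by (intro response_eq_0_imp_AE_0[OF \<omega>(1), of "\<lambda>s. u s - v s"])
  then show ?thesis by eventually_elim simp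
qed

theorem Tikhonov_minimizers_converge:
  fixes q :: real and umin :: "real \<Rightarrow> real \<Rightarrow> real" and \<delta> :: "nat \<Rightarrow> real"
  assumes q: "2 \<le> q"
    and ubar: "is_arg_min J (integrable \<Lambda>) ubar"
    and J_fin: "J ubar < \<infinity>"
    and ubar_q: "integrable \<Lambda> (\<lambda>x. \<bar>ubar x\<bar> powr q)"
    and umin: "\<And>\<delta>. \<delta> > 0 \<Longrightarrow>
        is_arg_min (\<lambda>u. J u + ennreal \<delta> * (\<integral>\<^sup>+x. ennreal (\<bar>u x\<bar> powr q) \<partial>\<Lambda>)) (integrable \<Lambda>) (umin \<delta>)"
    and \<delta>: "\<And>n. \<delta> n > 0" "decseq \<delta>" "\<delta> \<longlonglongrightarrow> 0"
  shows "(\<lambda>n. \<integral>s. \<bar>umin (\<delta> n) s - ubar s\<bar> \<partial>\<Lambda>) \<longlonglongrightarrow> 0"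
proof -
  obtain v where v: "integrable \<Lambda> v" "(\<lambda>n. \<integral>s. \<bar>umin (\<delta> n) s - v s\<bar> \<partial>\<Lambda>) \<longlonglongrightarrow> 0"
    "(\<lambda>n. J (umin (\<delta> n))) \<longlonglongrightarrow> J ubar"
  proof (rule Tikhonov_minimizers_L1_converge[of \<Lambda> q J ubar umin \<delta>])
    show "J (\<lambda>x. (u x + v x) / 2) \<le> max (J u) (J v)" if "integrable \<Lambda> u" "integrable \<Lambda> v" for u v
      using that by (rule J_midpoint_max)
    show "is_arg_min (\<lambda>u. J u + ennreal \<epsilon> * (\<integral>\<^sup>+x. ennreal (\<bar>u x\<bar> powr q) \<partial>\<Lambda>)) (integrable \<Lambda>) (umin \<epsilon>)"
      if "\<epsilon> > 0" for \<epsilon>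
      using that by (rule umin)
  qed (rule finite_\<Lambda> q ubar J_fin ubar_q \<delta> | blast)+
  have u_int: "integrable \<Lambda> (umin (\<delta> n))" for n
    using umin[OF \<delta>(1)] by (simp add: is_arg_min_def)
  have ubar_int: "integrable \<Lambda> ubar" using ubar by (simp add: is_arg_min_def)
  have "J v \<le> J ubar"
    by (rule J_lower_semicontinuous[OF u_int v])
  then have "AE t in \<Lambda>. ubar t = v t"
    using ubar by (intro minimizer_unique ubar_int v(1) J_fin) (auto simp: is_arg_min_linorder)
  then have "(\<integral>s. \<bar>umin (\<delta> n) s - v s\<bar> \<partial>\<Lambda>) = (\<integral>s. \<bar>umin (\<delta> n) s - ubar s\<bar> \<partial>\<Lambda>)" for n
    using u_int[of n] v(1) ubar_int by (intro integral_cong_AE) auto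
  with v(2) show ?thesis by simp
qed

section \<open>Finiteness of the cost\<close>

text \<open>The state for the control \<open>0\<close> is the integral of \<open>f s * m s\<close>, where \<open>f\<close> is the product of
  \<open>g t / g s\<close> and \<open>\<bar>z s\<bar> / m s\<close>. The \<open>\<beta>\<close>-th power moves inside by Jensen's inequality with weight \<open>m\<close>, and
  Young's inequality then separates the two factors, which are dependent in general: the moments of
  the second are controlled by \<open>m\<close>, and \<open>\<beta> < p\<close> leaves room for a finite moment of the first. In
  effect this is Minkowski's integral inequality, with the time integral of the \<open>L\<^sup>p\<close> norms of \<open>z\<close>
  on the right.\<close>

lemma uncontrolled_moment_bound:
  fixes m :: "real \<Rightarrow> real" and \<beta> p C :: real
  assumes \<beta>: "1 \<le> \<beta>" "\<beta> < p"
    and m: "integrable \<Lambda> m" "\<And>s. s \<in> {0..T} \<Longrightarrow> 1 \<le> m s"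
    and z_m: "\<And>s. s \<in> {0..T} \<Longrightarrow> (\<integral>\<^sup>+ \<omega>. ennreal ((\<bar>z s \<omega>\<bar> / m s) powr p) \<partial>M) \<le> 1"
    and g_moment: "\<And>s t. 0 \<le> s \<Longrightarrow> s \<le> t \<Longrightarrow> t \<le> T \<Longrightarrow>
      (\<integral>\<^sup>+ \<omega>. ennreal ((g t \<omega> / g s \<omega>) powr (\<beta> * p / (p - \<beta>))) \<partial>M) \<le> ennreal C"
    and C: "0 \<le> C"
  obtains K where "0 \<le> K" "\<And>t. t \<in> {0..T} \<Longrightarrow> (\<integral>\<^sup>+ \<omega>. ennreal (\<bar>\<xi> (\<lambda>_. 0) t \<omega>\<bar> powr \<beta>) \<partial>M) \<le> ennreal K"
proof -
  interpret L: sigma_finite_measure \<Lambda> by (rule sigma_finite_\<Lambda>)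
  interpret P: pair_sigma_finite \<Lambda> M by (rule pair_sigma_finite_\<Lambda>)
  note [measurable] = z_meas borel_measurable_integrable[OF m(1)]
  define \<rho> where "\<rho> = \<beta> * p / (p - \<beta>)"
  define V where "V = (\<integral>s. m s \<partial>\<Lambda>)"
  define D where "D = 2 powr \<beta> * V powr (\<beta> - 1)"
  have V_pos: "V > 0"
  proof -
    have "T = (\<integral>s. 1 \<partial>\<Lambda>)" using T_pos by (simp add: measure_restrict_space)
    also have "\<dots> \<le> V" unfolding V_def
      using m by (intro integral_mono) auto
    finally show ?thesis using T_pos by simp
  qed
  have D_pos: "D > 0" using V_pos by (simp add: D_def)
  have bound: "(\<integral>\<^sup>+ \<omega>. ennreal (\<bar>\<xi> (\<lambda>_. 0) t \<omega>\<bar> powr \<beta>) \<partial>M) \<le> ennreal (D * ((C + 1) * V))" if t: "t \<in> {0..T}" for t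
  proof -
    define f where "f s \<omega> = indicator {0..t} s * (g t \<omega> / g s \<omega> * (\<bar>z s \<omega>\<bar> / m s))" for s \<omega>
    define G where "G s \<omega> = ennreal (m s) * ((if s \<le> t then ennreal ((g t \<omega> / g s \<omega>) powr \<rho>) else 0)
         + ennreal ((\<bar>z s \<omega>\<bar> / m s) powr p))" for s \<omega>
    have [measurable]: "g t \<in> borel_measurable M" by (rule g_meas[OF t])
    have G_meas [measurable]: "(\<lambda>x. G (fst x) (snd x)) \<in> borel_measurable (\<Lambda> \<Otimes>\<^sub>M M)"
    proof -
      have [measurable]: "(\<lambda>x. g t (snd x)) \<in> borel_measurable (\<Lambda> \<Otimes>\<^sub>M M)" by measurable
      show ?thesis unfolding G_def by measurable
    qed
    \<comment> \<open>If the right-hand side is infinite there is nothing to prove; otherwise all the integrals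
      are those of integrable functions.\<close>
    have pathwise: "ennreal (\<bar>\<xi> (\<lambda>_. 0) t \<omega>\<bar> powr \<beta>) \<le> ennreal D * (\<integral>\<^sup>+ s. G s \<omega> \<partial>\<Lambda>)" if \<omega>: "\<omega> \<in> space M" for \<omega>
    proof (cases "(\<integral>\<^sup>+ s. G s \<omega> \<partial>\<Lambda>) = \<infinity>")
      case True
      then show ?thesis using D_pos by (simp add: ennreal_mult_top)
    next
      case False
      have gt: "g t \<omega> > 0" using g_pos[OF \<omega> t] .
      have f_nonneg: "0 \<le> f s \<omega>" if "s \<in> space \<Lambda>" for s
        using that g_pos[OF \<omega>, of s] gt m(2)[of s] by (auto simp: f_def indicator_def)
      have f_le: "ennreal (f s \<omega> powr \<beta> * m s) \<le> G s \<omega>" if s: "s \<in> space \<Lambda>" for s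
      proof -
        have ms: "m s > 0" using m(2)[of s] s by simp
        have "f s \<omega> powr \<beta> \<le> (if s \<le> t then (g t \<omega> / g s \<omega>) powr \<rho> else 0) + (\<bar>z s \<omega>\<bar> / m s) powr p"
        proof (cases "s \<le> t")
          case True
          then show ?thesis
            using Young_powr[of "g t \<omega> / g s \<omega>" "\<bar>z s \<omega>\<bar> / m s" \<beta> p] \<beta> g_pos[OF \<omega>, of s] gt ms s
            by (simp add: f_def \<rho>_def)
        next
          case False
          then show ?thesis by (simp add: f_def)
        qed
        then have "f s \<omega> powr \<beta> * m s
            \<le> ((if s \<le> t then (g t \<omega> / g s \<omega>) powr \<rho> else 0) + (\<bar>z s \<omega>\<bar> / m s) powr p) * m s"
          using ms by (intro mult_right_mono) auto
        then have "ennreal (f s \<omega> powr \<beta> * m s)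
            \<le> ennreal (((if s \<le> t then (g t \<omega> / g s \<omega>) powr \<rho> else 0) + (\<bar>z s \<omega>\<bar> / m s) powr p) * m s)"
          by (rule ennreal_leI)
        also have "\<dots> = G s \<omega>"
          using ms by (simp add: G_def ennreal_mult mult.commute)
        finally show ?thesis .
      qed
      have [measurable]: "(\<lambda>s. g s \<omega>) \<in> borel_measurable \<Lambda>" by (rule g_path_meas[OF \<omega>])
      have [measurable]: "(\<lambda>s. z s \<omega>) \<in> borel_measurable \<Lambda>" using z_path[OF \<omega>] by auto
      have [measurable]: "(\<lambda>s. f s \<omega>) \<in> borel_measurable \<Lambda>"
        unfolding f_def by measurable
      have fw: "integrable \<Lambda> (\<lambda>s. f s \<omega> * m s)"
      proof (rule Bochner_Integration.integrable_cong[THEN iffD1, OF refl])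
        show "integrable \<Lambda> (\<lambda>s. g t \<omega> * (indicator {0..t} s * (\<bar>z s \<omega>\<bar> / g s \<omega>)))"
          using z_path[OF \<omega>] \<omega> by (intro integrable_mult_right integrable_indicator_Icc integrable_div_g integrable_abs)
        show "g t \<omega> * (indicator {0..t} s * (\<bar>z s \<omega>\<bar> / g s \<omega>)) = f s \<omega> * m s" if "s \<in> space \<Lambda>" for s
          using m(2)[of s] that by (simp add: f_def)
      qed
      have fb: "integrable \<Lambda> (\<lambda>s. f s \<omega> powr \<beta> * m s)"
      proof (rule integrableI_bounded)
        show "(\<lambda>s. f s \<omega> powr \<beta> * m s) \<in> borel_measurable \<Lambda>" by measurable
        have "(\<integral>\<^sup>+ s. ennreal (norm (f s \<omega> powr \<beta> * m s)) \<partial>\<Lambda>) \<le> (\<integral>\<^sup>+ s. G s \<omega> \<partial>\<Lambda>)"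
        proof (rule nn_integral_mono)
          fix s assume s: "s \<in> space \<Lambda>"
          then have "norm (f s \<omega> powr \<beta> * m s) = f s \<omega> powr \<beta> * m s" using m(2)[of s] by (simp add: abs_mult)
          then show "ennreal (norm (f s \<omega> powr \<beta> * m s)) \<le> G s \<omega>" using f_le[OF s] by simp
        qed
        then show "(\<integral>\<^sup>+ s. ennreal (norm (f s \<omega> powr \<beta> * m s)) \<partial>\<Lambda>) < \<infinity>"
          using False by (simp add: less_top)
      qed
      have "\<bar>\<xi> (\<lambda>_. 0) t \<omega>\<bar> \<le> (\<integral>s. f s \<omega> * m s \<partial>\<Lambda>)"
      proof -
        have "\<bar>\<integral>s. indicator {0..t} s * (z s \<omega> / g s \<omega>) \<partial>\<Lambda>\<bar> \<le> (\<integral>s. \<bar>indicator {0..t} s * (z s \<omega> / g s \<omega>)\<bar> \<partial>\<Lambda>)"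
          by (rule integral_abs_bound)
        then have "\<bar>\<xi> (\<lambda>_. 0) t \<omega>\<bar> \<le> g t \<omega> * (\<integral>s. \<bar>indicator {0..t} s * (z s \<omega> / g s \<omega>)\<bar> \<partial>\<Lambda>)"
          using gt by (simp add: \<xi>_def response_alt[OF t] abs_mult)
        also have "\<dots> = (\<integral>s. g t \<omega> * \<bar>indicator {0..t} s * (z s \<omega> / g s \<omega>)\<bar> \<partial>\<Lambda>)"
          by (rule integral_mult_right_zero[symmetric])
        also have "\<dots> = (\<integral>s. f s \<omega> * m s \<partial>\<Lambda>)"
        proof (rule Bochner_Integration.integral_cong[OF refl])
          fix s assume "s \<in> space \<Lambda>"
          then show "g t \<omega> * \<bar>indicator {0..t} s * (z s \<omega> / g s \<omega>)\<bar> = f s \<omega> * m s"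
            using g_pos[OF \<omega>, of s] m(2)[of s] by (simp add: f_def abs_mult)
        qed
        finally show ?thesis .
      qed
      then have "\<bar>\<xi> (\<lambda>_. 0) t \<omega>\<bar> powr \<beta> \<le> (\<integral>s. f s \<omega> * m s \<partial>\<Lambda>) powr \<beta>"
        using \<beta> by (intro powr_mono2) auto
      also have "\<dots> \<le> D * (\<integral>s. f s \<omega> powr \<beta> * m s \<partial>\<Lambda>)"
        unfolding D_def V_def
      proof (rule powr_integral_le_integral_powr[OF \<beta>(1) f_nonneg _ m(1) fw fb])
        show "0 \<le> m s" if "s \<in> space \<Lambda>" for s using m(2)[of s] that by simp
        show "0 < (\<integral>s. m s \<partial>\<Lambda>)" using V_pos by (simp add: V_def)
      qed
      finally have "ennreal (\<bar>\<xi> (\<lambda>_. 0) t \<omega>\<bar> powr \<beta>) \<le> ennreal (D * (\<integral>s. f s \<omega> powr \<beta> * m s \<partial>\<Lambda>))"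
        by (rule ennreal_leI)
      also have "\<dots> = ennreal D * (\<integral>\<^sup>+ s. ennreal (f s \<omega> powr \<beta> * m s) \<partial>\<Lambda>)"
      proof -
        have nn: "AE s in \<Lambda>. 0 \<le> f s \<omega> powr \<beta> * m s"
          using m(2) by (intro AE_I2) (auto intro!: mult_nonneg_nonneg intro: order_trans[OF zero_le_one])
        show ?thesis
          using D_pos nn_integral_eq_integral[OF fb nn] integral_nonneg_AE[OF nn] by (simp add: ennreal_mult)
      qed
      also have "\<dots> \<le> ennreal D * (\<integral>\<^sup>+ s. G s \<omega> \<partial>\<Lambda>)"
        by (intro mult_left_mono nn_integral_mono f_le) auto
      finally show ?thesis .
    qed
    have slice: "(\<integral>\<^sup>+ \<omega>. G s \<omega> \<partial>M) \<le> ennreal (m s) * ennreal (C + 1)" if s: "s \<in> space \<Lambda>" for s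
    proof -
      have s': "s \<in> {0..T}" using s by simp
      have [measurable]: "g s \<in> borel_measurable M" by (rule g_meas[OF s'])
      have [measurable]: "(\<lambda>\<omega>. z s \<omega>) \<in> borel_measurable M"
        using measurable_compose[OF measurable_Pair1' z_meas] s by simp
      have "(\<integral>\<^sup>+ \<omega>. G s \<omega> \<partial>M) = ennreal (m s) * ((if s \<le> t then (\<integral>\<^sup>+ \<omega>. ennreal ((g t \<omega> / g s \<omega>) powr \<rho>) \<partial>M) else 0)
           + (\<integral>\<^sup>+ \<omega>. ennreal ((\<bar>z s \<omega>\<bar> / m s) powr p) \<partial>M))"
        unfolding G_def by (simp add: nn_integral_cmult nn_integral_add)
      also have "\<dots> \<le> ennreal (m s) * (ennreal C + 1)"
      proof (intro mult_left_mono add_mono z_m s')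
        show "(if s \<le> t then (\<integral>\<^sup>+ \<omega>. ennreal ((g t \<omega> / g s \<omega>) powr \<rho>) \<partial>M) else 0) \<le> ennreal C"
          using g_moment[of s t] t s' by (auto simp: \<rho>_def)
      qed auto
      also have "ennreal C + 1 = ennreal (C + 1)" using C by simp
      finally show ?thesis .
    qed
    have inner_meas: "(\<lambda>\<omega>. \<integral>\<^sup>+ s. G s \<omega> \<partial>\<Lambda>) \<in> borel_measurable M"
    proof -
      have "(\<lambda>x. G (snd x) (fst x)) \<in> borel_measurable (M \<Otimes>\<^sub>M \<Lambda>)"
        using measurable_compose[OF measurable_pair_swap' G_meas] by (simp add: split_beta)
      then show ?thesis
        by (intro L.borel_measurable_nn_integral) (simp add: split_beta)
    qed
    have "(\<integral>\<^sup>+ \<omega>. (\<integral>\<^sup>+ s. G s \<omega> \<partial>\<Lambda>) \<partial>M) = (\<integral>\<^sup>+ s. (\<integral>\<^sup>+ \<omega>. G s \<omega> \<partial>M) \<partial>\<Lambda>)"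
      using P.nn_integral_snd[OF G_meas] nn_integral_fst[OF G_meas] by simp
    also have "\<dots> \<le> (\<integral>\<^sup>+ s. ennreal (m s) * ennreal (C + 1) \<partial>\<Lambda>)"
      by (intro nn_integral_mono slice)
    also have "\<dots> = (\<integral>\<^sup>+ s. ennreal (m s) \<partial>\<Lambda>) * ennreal (C + 1)"
      by (intro nn_integral_multc) measurable
    also have "(\<integral>\<^sup>+ s. ennreal (m s) \<partial>\<Lambda>) = ennreal V"
      unfolding V_def using m by (intro nn_integral_eq_integral AE_I2) (auto intro: order_trans[OF zero_le_one])
    finally have G_le: "(\<integral>\<^sup>+ \<omega>. (\<integral>\<^sup>+ s. G s \<omega> \<partial>\<Lambda>) \<partial>M) \<le> ennreal V * ennreal (C + 1)" .
    have "(\<integral>\<^sup>+ \<omega>. ennreal (\<bar>\<xi> (\<lambda>_. 0) t \<omega>\<bar> powr \<beta>) \<partial>M) \<le> (\<integral>\<^sup>+ \<omega>. ennreal D * (\<integral>\<^sup>+ s. G s \<omega> \<partial>\<Lambda>) \<partial>M)"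
      by (intro nn_integral_mono pathwise)
    also have "\<dots> = ennreal D * (\<integral>\<^sup>+ \<omega>. (\<integral>\<^sup>+ s. G s \<omega> \<partial>\<Lambda>) \<partial>M)"
      by (rule nn_integral_cmult[OF inner_meas])
    also have "\<dots> \<le> ennreal D * (ennreal V * ennreal (C + 1))"
      by (intro mult_left_mono G_le) simp
    also have "\<dots> = ennreal (D * ((C + 1) * V))"
      using D_pos V_pos C by (simp only: ennreal_mult less_imp_le add_nonneg_nonneg zero_le_one mult_nonneg_nonneg mult.commute)
    finally show ?thesis .
  qed
  show thesis
    by (rule that[of "D * ((C + 1) * V)"]) (use bound D_pos V_pos C in auto)
qed

lemma J_zero_finite:
  fixes m L :: "real \<Rightarrow> real" and \<alpha> p :: real
  assumes \<alpha>: "0 < \<alpha>" "\<alpha> < p" and p: "1 < p"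
    and L: "integrable \<Lambda> L" "\<And>t. t \<in> {0..T} \<Longrightarrow> 0 \<le> L t"
    and growth: "\<And>t x. t \<in> {0..T} \<Longrightarrow> F t x \<le> L t * (1 + \<bar>x\<bar> powr \<alpha>)"
    and m: "integrable \<Lambda> m" "\<And>s. s \<in> {0..T} \<Longrightarrow> 1 \<le> m s"
    and z_m: "\<And>s. s \<in> {0..T} \<Longrightarrow> (\<integral>\<^sup>+ \<omega>. ennreal ((\<bar>z s \<omega>\<bar> / m s) powr p) \<partial>M) \<le> 1"
    and g_moment: "\<And>\<rho>. 0 < \<rho> \<Longrightarrow> \<exists>C\<ge>0. \<forall>s t. 0 \<le> s \<and> s \<le> t \<and> t \<le> T \<longrightarrow>
      (\<integral>\<^sup>+ \<omega>. ennreal ((g t \<omega> / g s \<omega>) powr \<rho>) \<partial>M) \<le> ennreal C"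
  shows "J (\<lambda>_. 0) < \<infinity>"
proof -
  interpret MP: pair_sigma_finite M \<Lambda>
    by (intro pair_sigma_finite.intro sigma_finite_\<Lambda>) unfold_locales
  \<comment> \<open>Jensen's inequality needs an exponent of at least \<open>1\<close>.\<close>
  define \<beta> where "\<beta> = max \<alpha> 1"
  have \<beta>: "1 \<le> \<beta>" "\<beta> < p" "\<alpha> \<le> \<beta>" using \<alpha> p by (auto simp: \<beta>_def)
  have "0 < \<beta> * p / (p - \<beta>)" using \<beta> by simp
  from g_moment[OF this] obtain C where C: "0 \<le> C" "\<And>s t. 0 \<le> s \<Longrightarrow> s \<le> t \<Longrightarrow> t \<le> T \<Longrightarrow>
      (\<integral>\<^sup>+ \<omega>. ennreal ((g t \<omega> / g s \<omega>) powr (\<beta> * p / (p - \<beta>))) \<partial>M) \<le> ennreal C" by blast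
  obtain K where K: "0 \<le> K" "\<And>t. t \<in> {0..T} \<Longrightarrow> (\<integral>\<^sup>+ \<omega>. ennreal (\<bar>\<xi> (\<lambda>_. 0) t \<omega>\<bar> powr \<beta>) \<partial>M) \<le> ennreal K"
    using uncontrolled_moment_bound[OF \<beta>(1,2) m z_m C(2) C(1)] by blast
  have zero_int: "integrable \<Lambda> (\<lambda>_. 0 :: real)" by simp
  have slice: "(\<integral>\<^sup>+ \<omega>. ennreal (running_cost (\<lambda>_. 0) (\<omega>, t)) \<partial>M) \<le> ennreal (L t * (2 + K))" if "t \<in> space \<Lambda>" for t
  proof -
    have t: "t \<in> {0..T}" using that by simp
    have [measurable]: "(\<lambda>\<omega>. \<xi> (\<lambda>_. 0) t \<omega>) \<in> borel_measurable M"
      unfolding \<xi>_def by (rule response_meas[OF control_error_joint[OF zero_int] t])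
    have "(\<integral>\<^sup>+ \<omega>. ennreal (running_cost (\<lambda>_. 0) (\<omega>, t)) \<partial>M)
        \<le> (\<integral>\<^sup>+ \<omega>. ennreal (L t) * (2 + ennreal (\<bar>\<xi> (\<lambda>_. 0) t \<omega>\<bar> powr \<beta>)) \<partial>M)"
    proof (rule nn_integral_mono)
      fix \<omega>
      let ?x = "\<bar>\<xi> (\<lambda>_. 0) t \<omega>\<bar>"
      have "?x powr \<alpha> \<le> 1 + ?x powr \<beta>"
      proof (cases "?x \<le> 1")
        case True
        then have "?x powr \<alpha> \<le> 1 powr \<alpha>" using \<alpha> by (intro powr_mono2) auto
        then show ?thesis by (simp add: add_increasing2)
      next
        case False
        then have "?x powr \<alpha> \<le> ?x powr \<beta>" using \<beta> by (intro powr_mono) auto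
        then show ?thesis by simp
      qed
      then have "L t * (1 + ?x powr \<alpha>) \<le> L t * (2 + ?x powr \<beta>)"
        using L(2)[OF t] by (intro mult_left_mono) auto
      then have "F t (\<xi> (\<lambda>_. 0) t \<omega>) \<le> L t * (2 + ?x powr \<beta>)"
        using growth[OF t, of "\<xi> (\<lambda>_. 0) t \<omega>"] by linarith
      then have "ennreal (F t (\<xi> (\<lambda>_. 0) t \<omega>)) \<le> ennreal (L t * (2 + ?x powr \<beta>))"
        by (rule ennreal_leI)
      then show "ennreal (running_cost (\<lambda>_. 0) (\<omega>, t)) \<le> ennreal (L t) * (2 + ennreal (?x powr \<beta>))"
        using L(2)[OF t] by (simp add: running_cost_def ennreal_mult)
    qed
    also have "\<dots> = ennreal (L t) * (2 + (\<integral>\<^sup>+ \<omega>. ennreal (\<bar>\<xi> (\<lambda>_. 0) t \<omega>\<bar> powr \<beta>) \<partial>M))"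
      by (simp add: nn_integral_cmult nn_integral_add emeasure_space_1)
    also have "\<dots> \<le> ennreal (L t) * (2 + ennreal K)"
      by (intro mult_left_mono add_left_mono K t) auto
    also have "\<dots> = ennreal (L t * (2 + K))"
      using L(2)[OF t] K(1) by (simp add: ennreal_mult)
    finally show ?thesis .
  qed
  have meas: "(\<lambda>x. ennreal (running_cost (\<lambda>_. 0) x)) \<in> borel_measurable (M \<Otimes>\<^sub>M \<Lambda>)"
    using running_cost_meas[OF zero_int] by measurable
  have "J (\<lambda>_. 0) = (\<integral>\<^sup>+ t. (\<integral>\<^sup>+ \<omega>. ennreal (running_cost (\<lambda>_. 0) (\<omega>, t)) \<partial>M) \<partial>\<Lambda>)"
    unfolding J_eq_product_integral[OF zero_int] by (rule MP.nn_integral_snd[OF meas, symmetric])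
  also have "\<dots> \<le> (\<integral>\<^sup>+ t. ennreal (L t * (2 + K)) \<partial>\<Lambda>)"
    by (intro nn_integral_mono slice)
  also have "\<dots> = ennreal (\<integral>t. L t * (2 + K) \<partial>\<Lambda>)"
    using L K(1) by (intro nn_integral_eq_integral AE_I2) auto
  also have "\<dots> < \<infinity>" by simp
  finally show ?thesis .
qed

end

section \<open>Random elements of C([0,T])\<close>

text \<open>This is what expresses closed balls of \<open>C([0,T])\<close> through countably many evaluations.\<close>

lemma continuous_le_from_rationals:
  fixes h :: "real \<Rightarrow> real"
  assumes T: "0 < T" and h: "continuous_on {0..T} h" and t: "t \<in> {0..T}"
    and le: "\<And>s. s \<in> {0..T} \<inter> \<rat> \<Longrightarrow> h s \<le> c"
  shows "h t \<le> c"
proof (rule ccontr)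
  assume "\<not> h t \<le> c"
  then have "h t \<in> {c<..}" by simp
  then obtain a b where ab: "a < b" "{a<..<b} \<subseteq> {0..T}" "\<And>s. s \<in> {a<..<b} \<Longrightarrow> h s \<in> {c<..}"
    using continuous_Icc_open_interval[OF T h t, of "{c<..}"] by auto
  obtain s where s: "s \<in> \<rat>" "a < s" "s < b" using Rats_dense_in_real[OF ab(1)] by blast
  with ab(2,3) le show False by force
qed

text \<open>The degree is read off from the list of coefficients, so that lists of rationals index a countable
  family of polynomials.\<close>

definition Bernstein_sum :: "real \<Rightarrow> real list \<Rightarrow> real \<Rightarrow> real" where
  "Bernstein_sum T c = restrict (\<lambda>t. \<Sum>k\<le>length c - 1. c ! k * Bernstein (length c - 1) k (t / T)) {0..T}"

lemma Bernstein_sum_in_C: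
  assumes "0 < T"
  shows "Bernstein_sum T c \<in> mspace (C_metric T)"
proof -
  have "continuous_on {0..T} (\<lambda>t. \<Sum>k\<le>length c - 1. c ! k * Bernstein (length c - 1) k (t / T))"
    unfolding Bernstein_def using assms by (intro continuous_intros) auto
  then have "continuous_on {0..T} (Bernstein_sum T c)"
    unfolding Bernstein_sum_def by (rule continuous_on_cong[THEN iffD1, rotated 2]) auto
  then show ?thesis by (simp add: mspace_C_metric Bernstein_sum_def)
qed

lemma mdist_C_metric_le:
  assumes "0 < T" "f \<in> mspace (C_metric T)" "g \<in> mspace (C_metric T)"
    and "\<And>t. t \<in> {0..T} \<Longrightarrow> \<bar>f t - g t\<bar> \<le> e"
  shows "mdist (C_metric T) f g \<le> e"
  unfolding mdist_C_metric[OF assms(1-3)] using assms(1,4) by (intro cSUP_least) auto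

lemma le_mdist_C_metric:
  assumes T: "0 < T" and f: "f \<in> mspace (C_metric T)" and g: "g \<in> mspace (C_metric T)" and t: "t \<in> {0..T}"
  shows "\<bar>f t - g t\<bar> \<le> mdist (C_metric T) f g"
proof -
  have "continuous_on {0..T} (\<lambda>t. \<bar>f t - g t\<bar>)"
    using f g by (auto simp: mspace_C_metric intro!: continuous_intros)
  then have "bdd_above ((\<lambda>t. \<bar>f t - g t\<bar>) ` {0..T})"
    by (intro bounded_imp_bdd_above compact_imp_bounded compact_continuous_image compact_Icc)
  then show ?thesis
    unfolding mdist_C_metric[OF T f g] by (rule cSUP_upper[OF t])
qed

text \<open>Bernstein polynomials approximate uniformly, and as they are a partition of unity, rounding each
  coefficient by at most \<open>e/4\<close> changes the sum by at most \<open>e/4\<close>.\<close>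

lemma rational_Bernstein_dense:
  assumes T: "0 < T" and f: "f \<in> mspace (C_metric T)" and e: "0 < e"
  obtains r :: "rat list" where "mdist (C_metric T) f (Bernstein_sum T (map of_rat r)) < e"
proof -
  have contf: "continuous_on {0..T} f" using f by (simp add: mspace_C_metric)
  have "continuous_on {0..1} (\<lambda>x. f (T * x))"
    using T by (intro continuous_on_compose2[OF contf] continuous_intros) (auto intro: mult_left_le)
  from Bernstein_Weierstrass[OF this, of "e/4"] e obtain n where
    "\<forall>m x. n \<le> m \<and> x \<in> {0..1} \<longrightarrow> \<bar>f (T * x) - (\<Sum>k\<le>m. f (T * (k / m)) * Bernstein m k x)\<bar> < e / 4"
    by auto
  then have n: "\<bar>f (T * x) - (\<Sum>k\<le>n. f (T * (k / n)) * Bernstein n k x)\<bar> < e / 4" if "x \<in> {0..1}" for x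
    using that by blast
  have "\<forall>k. \<exists>q :: rat. \<bar>f (T * (real k / real n)) - of_rat q\<bar> < e / 4"
  proof
    fix k :: nat
    obtain q :: rat where "f (T * (real k / real n)) - e / 4 < of_rat q" "of_rat q < f (T * (real k / real n)) + e / 4"
      using of_rat_dense[of "f (T * (real k / real n)) - e / 4" "f (T * (real k / real n)) + e / 4"] e by auto
    then show "\<exists>q :: rat. \<bar>f (T * (real k / real n)) - of_rat q\<bar> < e / 4"
      by (intro exI[of _ q]) (simp add: abs_if)
  qed
  then obtain q :: "nat \<Rightarrow> rat" where q: "\<And>k. \<bar>f (T * (real k / real n)) - of_rat (q k)\<bar> < e / 4"
    by metis
  define r where "r = map q [0..<Suc n]"
  have Bs: "Bernstein_sum T (map of_rat r) t = (\<Sum>k\<le>n. of_rat (q k) * Bernstein n k (t / T))"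
    if "t \<in> {0..T}" for t
    using that unfolding Bernstein_sum_def r_def
    by (auto simp del: upt_Suc intro!: sum.cong)
  have "mdist (C_metric T) f (Bernstein_sum T (map of_rat r)) \<le> e / 2"
  proof (rule mdist_C_metric_le[OF T f Bernstein_sum_in_C[OF T]])
    fix t assume t: "t \<in> {0..T}"
    define x where "x = t / T"
    have x: "x \<in> {0..1}" "T * x = t" using t T by (auto simp: x_def)
    have "\<bar>(\<Sum>k\<le>n. f (T * (k / n)) * Bernstein n k x) - (\<Sum>k\<le>n. of_rat (q k) * Bernstein n k x)\<bar>
        = \<bar>\<Sum>k\<le>n. (f (T * (k / n)) - of_rat (q k)) * Bernstein n k x\<bar>"
      by (simp add: sum_subtractf left_diff_distrib)
    also have "\<dots> \<le> (\<Sum>k\<le>n. \<bar>(f (T * (k / n)) - of_rat (q k)) * Bernstein n k x\<bar>)"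
      by (rule sum_abs)
    also have "\<dots> \<le> (\<Sum>k\<le>n. e / 4 * Bernstein n k x)"
    proof (intro sum_mono)
      fix k
      have "0 \<le> Bernstein n k x" using x(1) by (intro Bernstein_nonneg) auto
      then show "\<bar>(f (T * (k / n)) - of_rat (q k)) * Bernstein n k x\<bar> \<le> e / 4 * Bernstein n k x"
        using less_imp_le[OF q[of k]] by (simp only: abs_mult abs_of_nonneg mult_right_mono)
    qed
    also have "\<dots> = e / 4" by (simp only: sum_distrib_left[symmetric] sum_Bernstein mult_1_right)
    finally show "\<bar>f t - Bernstein_sum T (map of_rat r) t\<bar> \<le> e / 2"
      using n[OF x(1)] e unfolding Bs[OF t] x(2) x_def[symmetric] by linarith
  qed
  then show thesis using that[of r] e by simp
qed

lemma openin_C_metric_Pow: "{U. openin (mtopology_of (C_metric T)) U} \<subseteq> Pow (mspace (C_metric T))"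
  using openin_subset[of "mtopology_of (C_metric T)"] by auto

lemma space_C_borel: "space (C_borel T) = mspace (C_metric T)"
  unfolding C_borel_def by (rule space_measure_of[OF openin_C_metric_Pow])

lemma sets_C_borel_openin: "openin (mtopology_of (C_metric T)) U \<Longrightarrow> U \<in> sets (C_borel T)"
  unfolding C_borel_def by (subst sets_measure_of[OF openin_C_metric_Pow]) auto

text \<open>The space is separable, so every open set is a countable union of closed balls around rational
  Bernstein sums, and a closed ball is described by the values at rational times.\<close>

lemma measurable_C_borel:
  assumes T: "0 < T"
    and Y: "\<And>\<omega>. \<omega> \<in> space M \<Longrightarrow> Y \<omega> \<in> mspace (C_metric T)"
    and meas: "\<And>t. t \<in> {0..T} \<Longrightarrow> (\<lambda>\<omega>. Y \<omega> t) \<in> borel_measurable M"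
  shows "Y \<in> measurable M (C_borel T)"
  unfolding C_borel_def
proof (rule measurable_measure_of)
  let ?d = "mdist (C_metric T)"
  interpret C: Metric_space "mspace (C_metric T)" ?d by (rule Metric_space_mspace_mdist)
  show "{U. openin (mtopology_of (C_metric T)) U} \<subseteq> Pow (mspace (C_metric T))"
    by (rule openin_C_metric_Pow)
  show "Y \<in> space M \<rightarrow> mspace (C_metric T)" using Y by auto
  fix U assume "U \<in> {U. openin (mtopology_of (C_metric T)) U}"
  then have U: "openin C.mtopology U" by (simp add: mtopology_of_def)
  let ?p = "\<lambda>r :: rat list. Bernstein_sum T (map of_rat r)"
  have closed_ball: "{\<omega> \<in> space M. ?d (Y \<omega>) (?p r) \<le> e} \<in> sets M" for r and e :: real
  proof -
    have "?d (Y \<omega>) (?p r) \<le> e \<longleftrightarrow> (\<forall>t \<in> {0..T} \<inter> \<rat>. \<bar>Y \<omega> t - ?p r t\<bar> \<le> e)" if \<omega>: "\<omega> \<in> space M" for \<omega>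
    proof
      assume "?d (Y \<omega>) (?p r) \<le> e"
      then show "\<forall>t \<in> {0..T} \<inter> \<rat>. \<bar>Y \<omega> t - ?p r t\<bar> \<le> e"
        using le_mdist_C_metric[OF T Y[OF \<omega>] Bernstein_sum_in_C[OF T]] by (meson IntD1 order_trans)
    next
      assume rat: "\<forall>t \<in> {0..T} \<inter> \<rat>. \<bar>Y \<omega> t - ?p r t\<bar> \<le> e"
      have "continuous_on {0..T} (\<lambda>t. \<bar>Y \<omega> t - ?p r t\<bar>)"
        using Y[OF \<omega>] Bernstein_sum_in_C[OF T, of "map of_rat r"]
        by (auto simp: mspace_C_metric intro!: continuous_intros)
      then show "?d (Y \<omega>) (?p r) \<le> e"
        using rat by (intro mdist_C_metric_le[OF T Y[OF \<omega>] Bernstein_sum_in_C[OF T]])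
          (auto intro: continuous_le_from_rationals[OF T])
    qed
    then have "{\<omega> \<in> space M. ?d (Y \<omega>) (?p r) \<le> e}
        = {\<omega> \<in> space M. \<forall>t \<in> {0..T} \<inter> \<rat>. \<bar>Y \<omega> t - ?p r t\<bar> \<le> e}" by blast
    also have "\<dots> \<in> sets M"
    proof (rule sets.sets_Collect_countable_All')
      show "countable ({0..T} \<inter> \<rat>)" by (intro countable_Int2 countable_rat)
      fix t assume "t \<in> {0..T} \<inter> \<rat>"
      then have [measurable]: "(\<lambda>\<omega>. Y \<omega> t) \<in> borel_measurable M" using meas by auto
      show "{\<omega> \<in> space M. \<bar>Y \<omega> t - ?p r t\<bar> \<le> e} \<in> sets M" by measurable
    qed
    finally show ?thesis .
  qed
  define I where "I = {(r, e). e \<in> \<rat> \<and> C.mcball (?p r) e \<subseteq> U}"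
  have "I \<subseteq> UNIV \<times> \<rat>" by (auto simp: I_def)
  then have I: "countable I"
    by (rule countable_subset) (intro countable_SIGMA countable_rat countableI_type)
  have "Y -` U \<inter> space M = (\<Union>(r, e)\<in>I. {\<omega> \<in> space M. ?d (Y \<omega>) (?p r) \<le> e})"
  proof (intro set_eqI iffI)
    fix \<omega> assume "\<omega> \<in> Y -` U \<inter> space M"
    then have \<omega>: "\<omega> \<in> space M" "Y \<omega> \<in> U" by auto
    obtain \<epsilon> where \<epsilon>: "\<epsilon> > 0" "C.mball (Y \<omega>) \<epsilon> \<subseteq> U"
      using U \<omega>(2) by (auto simp: C.openin_mtopology)
    obtain r where r: "?d (Y \<omega>) (?p r) < \<epsilon> / 3"
      using rational_Bernstein_dense[OF T Y[OF \<omega>(1)], of "\<epsilon> / 3"] \<epsilon>(1) by auto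
    obtain e where e: "e \<in> \<rat>" "\<epsilon> / 3 < e" "e < \<epsilon> / 2"
      using Rats_dense_in_real[of "\<epsilon> / 3" "\<epsilon> / 2"] \<epsilon>(1) by auto
    have "C.mcball (?p r) e \<subseteq> C.mball (Y \<omega>) \<epsilon>"
    proof
      fix x assume x: "x \<in> C.mcball (?p r) e"
      then have "?d (Y \<omega>) x \<le> ?d (Y \<omega>) (?p r) + ?d (?p r) x"
        using Y[OF \<omega>(1)] by (intro C.triangle) auto
      then show "x \<in> C.mball (Y \<omega>) \<epsilon>"
        using x r e(3) \<epsilon>(1) Y[OF \<omega>(1)] by auto
    qed
    then have "(r, e) \<in> I" using e(1) \<epsilon>(2) by (auto simp: I_def)
    then show "\<omega> \<in> (\<Union>(r, e)\<in>I. {\<omega> \<in> space M. ?d (Y \<omega>) (?p r) \<le> e})"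
      using r e(2) \<omega>(1) by (auto intro!: bexI[of _ "(r, e)"])
  next
    fix \<omega> assume "\<omega> \<in> (\<Union>(r, e)\<in>I. {\<omega> \<in> space M. ?d (Y \<omega>) (?p r) \<le> e})"
    then obtain r e where re: "C.mcball (?p r) e \<subseteq> U" "\<omega> \<in> space M" "?d (Y \<omega>) (?p r) \<le> e"
      by (auto simp: I_def)
    then have "Y \<omega> \<in> C.mcball (?p r) e"
      using Y[OF re(2)] Bernstein_sum_in_C[OF T] by (simp add: C.commute)
    with re show "\<omega> \<in> Y -` U \<inter> space M" by auto
  qed
  also have "\<dots> \<in> sets M"
    using I by (rule sets.countable_UN') (auto intro: closed_ball)
  finally show "Y -` U \<inter> space M \<in> sets M" .
qed

text \<open>Dominated convergence, applied to the composition with a bounded continuous functional.\<close>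

lemma AE_convergent_imp_weak_conv_C:
  assumes M: "prob_space M"
    and Ys: "\<And>n. Ys n \<in> measurable M (C_borel T)" and Y: "Y \<in> measurable M (C_borel T)"
    and conv: "AE \<omega> in M. (\<lambda>n. mdist (C_metric T) (Ys n \<omega>) (Y \<omega>)) \<longlonglongrightarrow> 0"
  shows "weak_conv_C T (\<lambda>n. distr M (C_borel T) (Ys n)) (distr M (C_borel T) Y)"
  unfolding weak_conv_C_def
proof (intro allI impI, elim conjE)
  let ?X = "mtopology_of (C_metric T)"
  interpret prob_space M by (fact M)
  interpret C: Metric_space "mspace (C_metric T)" "mdist (C_metric T)" by (rule Metric_space_mspace_mdist)
  fix \<Phi> assume \<Phi>: "continuous_map ?X euclideanreal \<Phi>" and bnd: "bounded (\<Phi> ` mspace (C_metric T))"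
  have \<Phi>_meas: "\<Phi> \<in> borel_measurable (C_borel T)"
  proof (rule borel_measurableI)
    fix S :: "real set" assume "open S"
    then have "openin ?X {x \<in> topspace ?X. \<Phi> x \<in> S}"
      using openin_continuous_map_preimage[OF \<Phi>, of S] by simp
    then have "{x \<in> mspace (C_metric T). \<Phi> x \<in> S} \<in> sets (C_borel T)"
      by (intro sets_C_borel_openin) simp
    also have "{x \<in> mspace (C_metric T). \<Phi> x \<in> S} = \<Phi> -` S \<inter> space (C_borel T)"
      by (auto simp: space_C_borel)
    finally show "\<Phi> -` S \<inter> space (C_borel T) \<in> sets (C_borel T)" .
  qed
  obtain B where B: "\<And>f. f \<in> mspace (C_metric T) \<Longrightarrow> \<bar>\<Phi> f\<bar> \<le> B"
    using bnd by (auto simp: bounded_iff)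
  have in_C: "Ys n \<omega> \<in> mspace (C_metric T)" "Y \<omega> \<in> mspace (C_metric T)" if "\<omega> \<in> space M" for n \<omega>
    using measurable_space[OF Ys that] measurable_space[OF Y that] by (auto simp: space_C_borel)
  have "(\<lambda>n. \<integral>\<omega>. \<Phi> (Ys n \<omega>) \<partial>M) \<longlonglongrightarrow> (\<integral>\<omega>. \<Phi> (Y \<omega>) \<partial>M)"
  proof (rule integral_dominated_convergence)
    show "(\<lambda>\<omega>. \<Phi> (Y \<omega>)) \<in> borel_measurable M" by (rule measurable_compose[OF Y \<Phi>_meas])
    show "(\<lambda>\<omega>. \<Phi> (Ys n \<omega>)) \<in> borel_measurable M" for n by (rule measurable_compose[OF Ys \<Phi>_meas])
    show "integrable M (\<lambda>_. B)" by simp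
    show "AE \<omega> in M. norm (\<Phi> (Ys n \<omega>)) \<le> B" for n
      using B in_C by (intro AE_I2) auto
    show "AE \<omega> in M. (\<lambda>n. \<Phi> (Ys n \<omega>)) \<longlonglongrightarrow> \<Phi> (Y \<omega>)"
      using conv AE_space
    proof eventually_elim
      case (elim \<omega>)
      have "limitin C.mtopology (\<lambda>n. Ys n \<omega>) (Y \<omega>) sequentially"
        using elim in_C by (simp add: C.limitin_metric_dist_null)
      then have "limitin ?X (\<lambda>n. Ys n \<omega>) (Y \<omega>) sequentially"
        by (simp add: mtopology_of_def)
      from continuous_map_limit[OF \<Phi> this] show ?case by (simp add: o_def)
    qed
  qed
  then show "(\<lambda>n. \<integral>f. \<Phi> f \<partial>distr M (C_borel T) (Ys n)) \<longlonglongrightarrow> (\<integral>f. \<Phi> f \<partial>distr M (C_borel T) Y)"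
    by (simp add: integral_distr[OF Ys \<Phi>_meas] integral_distr[OF Y \<Phi>_meas])
qed

context linear_response
begin

text \<open>Restricted to \<open>[0,T]\<close>, because elements of \<open>C_metric T\<close> are undefined elsewhere.\<close>

definition solution :: "('a \<Rightarrow> real) \<Rightarrow> (real \<Rightarrow> real) \<Rightarrow> 'a \<Rightarrow> real \<Rightarrow> real" where
  "solution X0 u \<omega> = restrict (\<lambda>t. g t \<omega> * X0 \<omega> + response (\<lambda>s _. u s) t \<omega>) {0..T}"

lemma solution_in_C:
  assumes "\<omega> \<in> space M" "integrable \<Lambda> u"
  shows "solution X0 u \<omega> \<in> mspace (C_metric T)"
proof -
  have "continuous_on {0..T} (\<lambda>t. g t \<omega> * X0 \<omega> + response (\<lambda>s _. u s) t \<omega>)"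
    using assms by (intro continuous_intros g_cont response_continuous)
  then have "continuous_on {0..T} (solution X0 u \<omega>)"
    unfolding solution_def by (rule continuous_on_cong[THEN iffD1, rotated 2]) auto
  then show ?thesis by (simp add: mspace_C_metric solution_def)
qed

lemma solution_measurable:
  assumes X0: "X0 \<in> borel_measurable M" and u: "integrable \<Lambda> u"
  shows "solution X0 u \<in> measurable M (C_borel T)"
proof (rule measurable_C_borel[OF T_pos solution_in_C[OF _ u]])
  fix t assume t: "t \<in> {0..T}"
  have "u \<in> borel_measurable \<Lambda>" using u by auto
  then have "(\<lambda>(s, _). u s) \<in> borel_measurable (\<Lambda> \<Otimes>\<^sub>M M)" by measurable
  from response_meas[OF this t] have "(\<lambda>\<omega>. g t \<omega> * X0 \<omega> + response (\<lambda>s _. u s) t \<omega>) \<in> borel_measurable M"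
    using X0 g_meas[OF t] by measurable
  then show "(\<lambda>\<omega>. solution X0 u \<omega> t) \<in> borel_measurable M"
    using t by (simp add: solution_def)
qed

lemma solution_converges:
  assumes \<omega>: "\<omega> \<in> space M" and u: "\<And>n. integrable \<Lambda> (u n)" and v: "integrable \<Lambda> v"
    and conv: "(\<lambda>n. \<integral>s. \<bar>u n s - v s\<bar> \<partial>\<Lambda>) \<longlonglongrightarrow> 0"
  shows "(\<lambda>n. mdist (C_metric T) (solution X0 (u n) \<omega>) (solution X0 v \<omega>)) \<longlonglongrightarrow> 0"
proof -
  obtain K where K: "0 < K" "\<And>f t. t \<in> {0..T} \<Longrightarrow> integrable \<Lambda> (\<lambda>s. f s \<omega>) \<Longrightarrow>
      \<bar>response f t \<omega>\<bar> \<le> K * (\<integral>s. \<bar>f s \<omega>\<bar> \<partial>\<Lambda>)"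
    using response_bound[OF \<omega>] by metis
  have bound: "mdist (C_metric T) (solution X0 (u n) \<omega>) (solution X0 v \<omega>) \<le> K * (\<integral>s. \<bar>u n s - v s\<bar> \<partial>\<Lambda>)" for n
  proof (rule mdist_C_metric_le[OF T_pos solution_in_C[OF \<omega> u] solution_in_C[OF \<omega> v]])
    fix t assume t: "t \<in> {0..T}"
    have "solution X0 (u n) \<omega> t - solution X0 v \<omega> t = response (\<lambda>s _. 1 * u n s + (-1) * v s) t \<omega>"
      using t response_linear[OF \<omega> t u[of n] v, of 1 "-1"] by (simp add: solution_def)
    also have "\<bar>\<dots>\<bar> \<le> K * (\<integral>s. \<bar>1 * u n s + (-1) * v s\<bar> \<partial>\<Lambda>)"
      using u v by (intro K t) auto
    finally show "\<bar>solution X0 (u n) \<omega> t - solution X0 v \<omega> t\<bar> \<le> K * (\<integral>s. \<bar>u n s - v s\<bar> \<partial>\<Lambda>)"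
      by simp
  qed
  show ?thesis
  proof (rule Lim_null_comparison)
    show "\<forall>\<^sub>F n in sequentially. norm (mdist (C_metric T) (solution X0 (u n) \<omega>) (solution X0 v \<omega>))
        \<le> K * (\<integral>s. \<bar>u n s - v s\<bar> \<partial>\<Lambda>)"
      using bound by simp
    show "(\<lambda>n. K * (\<integral>s. \<bar>u n s - v s\<bar> \<partial>\<Lambda>)) \<longlonglongrightarrow> 0"
      using tendsto_mult_left[OF conv, of K] by simp
  qed
qed

end

section \<open>Brownian motion and convergence of the optimal states\<close>

text \<open>Completing the square turns the integrand into a multiple of the density of the normal law with
  mean \<open>r * \<sigma>\<^sup>2\<close>.\<close>

lemma normal_moment_generating:
  assumes "\<sigma> > 0"
  shows "(\<integral>\<^sup>+ x. ennreal (normal_density 0 \<sigma> x) * ennreal (exp (r * x)) \<partial>lborel) = ennreal (exp (r\<^sup>2 * \<sigma>\<^sup>2 / 2))"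
proof -
  have "normal_density 0 \<sigma> x * exp (r * x) = exp (r\<^sup>2 * \<sigma>\<^sup>2 / 2) * normal_density (r * \<sigma>\<^sup>2) \<sigma> x" for x
  proof -
    have "- x\<^sup>2 / (2 * \<sigma>\<^sup>2) + r * x = r\<^sup>2 * \<sigma>\<^sup>2 / 2 + - (x - r * \<sigma>\<^sup>2)\<^sup>2 / (2 * \<sigma>\<^sup>2)"
      using assms by (simp add: power2_eq_square field_simps)
    then show ?thesis
      unfolding normal_density_def by (simp add: mult_exp_exp)
  qed
  then have "(\<integral>\<^sup>+ x. ennreal (normal_density 0 \<sigma> x) * ennreal (exp (r * x)) \<partial>lborel)
     = (\<integral>\<^sup>+ x. ennreal (exp (r\<^sup>2 * \<sigma>\<^sup>2 / 2)) * ennreal (normal_density (r * \<sigma>\<^sup>2) \<sigma> x) \<partial>lborel)"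
    by (simp flip: ennreal_mult)
  also have "\<dots> = ennreal (exp (r\<^sup>2 * \<sigma>\<^sup>2 / 2)) * (\<integral>\<^sup>+ x. ennreal (normal_density (r * \<sigma>\<^sup>2) \<sigma> x) \<partial>lborel)"
    by (intro nn_integral_cmult) measurable
  also have "(\<integral>\<^sup>+ x. ennreal (normal_density (r * \<sigma>\<^sup>2) \<sigma> x) \<partial>lborel) = 1"
    using assms by (subst nn_integral_eq_integral) auto
  finally show ?thesis by simp
qed

lemma Brownian_increment_exponential_moment:
  assumes M: "prob_space M" and BM: "brownian_motion M Fil W" and st: "0 \<le> s" "s \<le> t"
  shows "(\<integral>\<^sup>+ \<omega>. ennreal (exp (r * (W t \<omega> - W s \<omega>))) \<partial>M) = ennreal (exp (r\<^sup>2 * (t - s) / 2))"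
proof (cases "s = t")
  case True
  interpret prob_space M by (fact M)
  show ?thesis using True by (simp add: emeasure_space_1)
next
  case False
  then have "s < t" using st by simp
  then have D: "distributed M lborel (\<lambda>\<omega>. W t \<omega> - W s \<omega>) (normal_density 0 (sqrt (t - s)))"
    using BM st by (auto simp: brownian_motion_def)
  from distributed_nn_integral[OF D, of "\<lambda>x. ennreal (exp (r * x))"] \<open>s < t\<close> show ?thesis
    by (simp add: normal_moment_generating)
qed

lemma drift_int_continuous_bounded:
  assumes T: "0 < T" and a: "in_Linf (lebesgue_on {0..T}) a"
  shows "continuous_on {0..T} (drift_int a)" "\<exists>K. \<forall>t\<in>{0..T}. \<bar>drift_int a t\<bar> \<le> K"
proof -
  interpret finite_measure "lebesgue_on {0..T}"
    by (rule finite_measure_lebesgue_on) (metis cbox_interval lmeasurable_cbox)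
  obtain C where C: "a \<in> borel_measurable (lebesgue_on {0..T})" "AE t in lebesgue_on {0..T}. \<bar>a t\<bar> \<le> C"
    using a by (auto simp: in_Linf_def)
  then have "integrable (lebesgue_on {0..T}) a"
    by (intro integrable_const_bound[of a C]) auto
  then show cont: "continuous_on {0..T} (drift_int a)"
    unfolding drift_int_def[abs_def] by (rule indefinite_integral_continuous_real)
  have "bounded (drift_int a ` {0..T})"
    by (intro compact_imp_bounded compact_continuous_image cont compact_Icc)
  then show "\<exists>K. \<forall>t\<in>{0..T}. \<bar>drift_int a t\<bar> \<le> K"
    by (auto simp: bounded_iff)
qed

theorem theorem5p15:
  fixes M :: "'a measure" and Fil :: "real \<Rightarrow> 'a measure"
    and W z :: "real \<Rightarrow> 'a \<Rightarrow> real" and X0 :: "'a \<Rightarrow> real"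
    and a L ubar :: "real \<Rightarrow> real" and F F1 F2 :: "real \<Rightarrow> real \<Rightarrow> real"
    and umin :: "real \<Rightarrow> real \<Rightarrow> real"
    and T p \<alpha> ptilde :: real
  assumes T: "T > 0"
    and filt: "filtered_prob_space M Fil"
    and BM: "brownian_motion M Fil W"
    and a: "in_Linf (lebesgue_on {0..T}) a"
    and p: "p \<ge> 2"
    and z_adapted: "\<And>t. t \<in> {0..T} \<Longrightarrow> z t \<in> borel_measurable (Fil t)"
    and z_joint: "(\<lambda>(t, \<omega>). z t \<omega>) \<in> borel_measurable (restrict_space borel {0..T} \<Otimes>\<^sub>M M)"
    and z_Lp: "\<And>t. t \<in> {0..T} \<Longrightarrow> in_Lp M p (z t)"
    and z_int: "(\<integral>\<^sup>+ t. ennreal ((\<integral>\<omega>. \<bar>z t \<omega>\<bar> powr p \<partial>M) powr (2 / p)) \<partial>lebesgue_on {0..T}) < \<infinity>"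
    and F_meas: "(\<lambda>(t, x). F t x) \<in> borel_measurable (restrict_space borel ({0..T} \<times> UNIV))"
    and F_nonneg: "\<And>t x. t \<in> {0..T} \<Longrightarrow> F t x \<ge> 0"
    and F_deriv1: "\<And>t x. t \<in> {0..T} \<Longrightarrow> (F t has_real_derivative F1 t x) (at x)"
    and F_deriv2: "\<And>t x. t \<in> {0..T} \<Longrightarrow> (F1 t has_real_derivative F2 t x) (at x)"
    and F1_cont: "continuous_on ({0..T} \<times> UNIV) (\<lambda>(t, x). F1 t x)"
    and F2_cont: "continuous_on ({0..T} \<times> UNIV) (\<lambda>(t, x). F2 t x)"
    and \<alpha>: "0 < \<alpha>" "\<alpha> < p"
    and L_nonneg: "\<And>t. t \<in> {0..T} \<Longrightarrow> L t \<ge> 0"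
    and L_int: "in_L1 T L"
    and F_growth: "\<And>t x. t \<in> {0..T} \<Longrightarrow>
          \<bar>F t x\<bar> + \<bar>F1 t x\<bar> + \<bar>F2 t x\<bar> \<le> L t * (1 + \<bar>x\<bar> powr \<alpha>)"
    and F_convex: "\<And>t. t \<in> {0..T} \<Longrightarrow> strictly_convex (F t)"
    and ubar_min: "is_arg_min (cost M T a W z F) (in_L1 T) ubar"
    and ptilde: "ptilde > 2 * sqrt 2"
    and ubar_Lp: "in_Lp (lebesgue_on {0..T}) ptilde ubar"
    and umin: "\<And>\<delta>. \<delta> > 0 \<Longrightarrow>
          is_arg_min (pen_cost M T a W z F (\<lambda>t. t powr ptilde) \<delta>) (in_L1 T) (umin \<delta>)"
    and X0_meas: "X0 \<in> borel_measurable (Fil 0)"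
    and X0_L2: "in_Lp M 2 X0"
  shows "\<exists>\<delta> :: nat \<Rightarrow> real. (\<forall>n. \<delta> n > 0) \<and> \<delta> \<longlonglongrightarrow> 0 \<and>
           conv_in_distr_C M T (\<lambda>n. sol_map a W X0 (umin (\<delta> n))) (sol_map a W X0 ubar)"
proof -
  have M: "prob_space M" using filt by (simp add: filtered_prob_space_def)
  interpret prob_space M by (fact M)
  let ?A = "drift_int a"
  obtain K where K: "\<And>t. t \<in> {0..T} \<Longrightarrow> \<bar>?A t\<bar> \<le> K"
    using drift_int_continuous_bounded(2)[OF T a] by blast
  have A_cont: "continuous_on {0..T} ?A" by (rule drift_int_continuous_bounded(1)[OF T a])
  have W_meas: "W t \<in> borel_measurable M" if "0 \<le> t" for t
    using that BM filt by (auto simp: brownian_motion_def filtered_prob_space_def intro: measurable_from_subalg)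
  let ?\<Lambda> = "lebesgue_on {0..T}"
  have z_joint': "(\<lambda>(t, \<omega>). z t \<omega>) \<in> borel_measurable (?\<Lambda> \<Otimes>\<^sub>M M)"
  proof -
    have "(\<lambda>t. t) \<in> ?\<Lambda> \<rightarrow>\<^sub>M restrict_space borel {0..T}"
      by (intro measurable_restrict_space2 continuous_imp_measurable_on_sets_lebesgue)
        (auto intro: continuous_intros)
    then have "(\<lambda>x. (fst x, snd x)) \<in> ?\<Lambda> \<Otimes>\<^sub>M M \<rightarrow>\<^sub>M restrict_space borel {0..T} \<Otimes>\<^sub>M M"
      by measurable
    from measurable_compose[OF this z_joint] show ?thesis by (simp add: split_beta)
  qed

  define N where "N s = (\<integral>\<omega>. \<bar>z s \<omega>\<bar> powr p \<partial>M)" for s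
  \<comment> \<open>The summand \<open>1\<close> permits division by \<open>m s\<close> where \<open>z s\<close> vanishes almost surely; it costs nothing, as
    constants are integrable on \<open>[0,T]\<close>. Integrability of \<open>m\<close> follows from that of its square.\<close>
  define m where "m s = 1 + N s powr (1 / p)" for s
  have N_nonneg: "N s \<ge> 0" for s unfolding N_def by (simp add: integral_nonneg_AE)
  have m_ge: "1 \<le> m s" for s by (simp add: m_def)
  note [measurable] = z_joint'
  have N_meas [measurable]: "N \<in> borel_measurable ?\<Lambda>"
    unfolding N_def by measurable
  have m_int: "integrable ?\<Lambda> m"
  proof -
    have sq: "integrable ?\<Lambda> (\<lambda>s. N s powr (2 / p))"
      using z_int N_meas unfolding N_def[symmetric] by (intro integrableI_bounded) auto
    show ?thesis
    proof (rule Bochner_Integration.integrable_bound)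
      show "integrable ?\<Lambda> (\<lambda>s. 2 + N s powr (2 / p))" using sq by auto
      show "m \<in> borel_measurable ?\<Lambda>" unfolding m_def by measurable
      show "AE s in ?\<Lambda>. norm (m s) \<le> norm (2 + N s powr (2 / p))"
      proof (rule AE_I2)
        fix s
        have "N s powr (1 / p) \<le> 1 + 1 powr (1 - 2) * (N s powr (1 / p)) powr 2"
          by (rule le_truncate_powr) auto
        then show "norm (m s) \<le> norm (2 + N s powr (2 / p))"
          using m_ge[of s] by (simp add: m_def powr_powr)
      qed
    qed
  qed
  have z_m: "(\<integral>\<^sup>+ \<omega>. ennreal ((\<bar>z s \<omega>\<bar> / m s) powr p) \<partial>M) \<le> 1" if s: "s \<in> {0..T}" for s
  proof -
    have int: "integrable M (\<lambda>\<omega>. \<bar>z s \<omega>\<bar> powr p)" using z_Lp[OF s] by (simp add: in_Lp_def)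
    have "N s \<le> m s powr p"
    proof -
      have "N s = (N s powr (1 / p)) powr p" using N_nonneg[of s] p by (simp add: powr_powr)
      also have "\<dots> \<le> m s powr p" using p by (intro powr_mono2) (auto simp: m_def)
      finally show ?thesis .
    qed
    moreover have "m s powr p > 0" using m_ge[of s] by simp
    ultimately have "N s / m s powr p \<le> 1" by simp
    have "(\<integral>\<^sup>+ \<omega>. ennreal ((\<bar>z s \<omega>\<bar> / m s) powr p) \<partial>M) = (\<integral>\<^sup>+ \<omega>. ennreal (\<bar>z s \<omega>\<bar> powr p / m s powr p) \<partial>M)"
      by (simp add: powr_divide)
    also have "\<dots> = ennreal (N s / m s powr p)"
      unfolding N_def using int by (subst nn_integral_eq_integral) auto
    also have "\<dots> \<le> 1" using \<open>N s / m s powr p \<le> 1\<close> by simp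
    finally show ?thesis .
  qed

  have "AE \<omega> in M. integrable ?\<Lambda> (\<lambda>t. z t \<omega>)"
  proof -
    \<comment> \<open>The claim concerns \<open>z\<close> alone; a constant \<open>g\<close> puts it within reach of the locale.\<close>
    interpret triv: linear_response M T "\<lambda>_ _. 1"
      by unfold_locales (use T in auto)
    show ?thesis
      by (rule triv.moment_imp_paths_integrable[OF z_joint' _ m_int m_ge z_m]) (use p in auto)
  qed
  moreover have "AE \<omega> in M. continuous_on {0..} (\<lambda>t. W t \<omega>)"
    using BM by (simp add: brownian_motion_def)
  ultimately have "AE \<omega> in M. integrable ?\<Lambda> (\<lambda>t. z t \<omega>) \<and> continuous_on {0..} (\<lambda>t. W t \<omega>)"
    by (rule AE_conjI)
  then obtain E where E: "{\<omega> \<in> space M. \<not> (integrable ?\<Lambda> (\<lambda>t. z t \<omega>) \<and> continuous_on {0..} (\<lambda>t. W t \<omega>))} \<subseteq> E"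
    "emeasure M E = 0" "E \<in> sets M"
    by (rule AE_E)
  have good: "AE \<omega> in M. \<omega> \<notin> E"
    using E by (intro AE_not_in) auto
  \<comment> \<open>Off the null set \<open>E\<close> nothing changes; on it, constant paths replace those of \<open>W\<close> and \<open>z\<close>.\<close>
  define W' where "W' t \<omega> = (if \<omega> \<in> E then 0 else W t \<omega>)" for t \<omega>
  define z' where "z' t \<omega> = (if \<omega> \<in> E then 0 else z t \<omega>)" for t \<omega>
  define g where "g t \<omega> = geom_bm W' t \<omega> * exp (?A t)" for t \<omega>
  have [measurable]: "E \<in> sets M" by (fact E(3))

  have z'_joint: "(\<lambda>(t, \<omega>). z' t \<omega>) \<in> borel_measurable (?\<Lambda> \<Otimes>\<^sub>M M)"
    unfolding z'_def by measurable
  interpret tracking_problem M T g z' F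
  proof unfold_locales
    show "0 < T" by (rule T)
    show "continuous_on {0..T} (\<lambda>t. g t \<omega>)" if \<omega>: "\<omega> \<in> space M" for \<omega>
    proof -
      have "continuous_on {0..T} (\<lambda>t. W' t \<omega>)"
      proof (cases "\<omega> \<in> E")
        case False
        then have "continuous_on {0..} (\<lambda>t. W t \<omega>)" using E(1) \<omega> by auto
        then show ?thesis using False by (auto simp: W'_def intro: continuous_on_subset)
      qed (simp add: W'_def)
      then show ?thesis
        unfolding g_def geom_bm_def by (intro continuous_intros A_cont) auto
    qed
    show "0 < g t \<omega>" for t \<omega> by (simp add: g_def geom_bm_def)
    show "g t \<in> borel_measurable M" if "t \<in> {0..T}" for t
    proof -
      have "W t \<in> borel_measurable M" using that by (intro W_meas) auto
      then show ?thesis unfolding g_def geom_bm_def W'_def by measurable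
    qed
    show "(\<lambda>(t, \<omega>). z' t \<omega>) \<in> borel_measurable (?\<Lambda> \<Otimes>\<^sub>M M)" by (rule z'_joint)
    show "integrable ?\<Lambda> (\<lambda>t. z' t \<omega>)" if "\<omega> \<in> space M" for \<omega>
      using that E(1) by (cases "\<omega> \<in> E") (auto simp: z'_def)
    show "(\<lambda>(t, x). F t x) \<in> borel_measurable (restrict_space borel ({0..T} \<times> UNIV))" by (rule F_meas)
    show "0 \<le> F t x" if "t \<in> {0..T}" for t x using that by (rule F_nonneg)
    show "continuous_on UNIV (F t)" if "t \<in> {0..T}" for t
      using F_deriv1[OF that] by (intro continuous_at_imp_continuous_on ballI DERIV_isCont)
    show "strictly_convex (F t)" if "t \<in> {0..T}" for t using that by (rule F_convex)
  qed

  have weight: "exp (- ?A s) / geom_bm W s \<omega> * y = y / g s \<omega>" if "\<omega> \<notin> E" for s \<omega> y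
    using that by (simp add: g_def geom_bm_def W'_def exp_minus field_simps)
  have g_good: "geom_bm W t \<omega> * exp (?A t) = g t \<omega>" if "\<omega> \<notin> E" for t \<omega>
    using that by (simp add: g_def geom_bm_def W'_def)
  have xi_good: "xi_proc a W z u t \<omega> = \<xi> u t \<omega>" if "\<omega> \<notin> E" for u t \<omega>
    unfolding xi_proc_def \<xi>_def response_def weight[OF that] g_good[OF that] using that by (simp add: z'_def)
  have cost_J: "cost M T a W z F = J"
  proof
    fix u
    show "cost M T a W z F u = J u"
      unfolding cost_def J_def
      by (rule nn_integral_cong_AE, use good in eventually_elim) (simp add: xi_good)
  qed
  have sol_good: "solution X0 u \<omega> t = sol_map a W X0 u t \<omega>" if "\<omega> \<notin> E" "t \<in> {0..T}" for u t \<omega>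
    unfolding sol_map_def solution_def response_def weight[OF that(1)] g_good[OF that(1)]
    using that by (simp add: distrib_left)

  have g_moment: "\<exists>C\<ge>0. \<forall>s t. 0 \<le> s \<and> s \<le> t \<and> t \<le> T \<longrightarrow>
      (\<integral>\<^sup>+ \<omega>. ennreal ((g t \<omega> / g s \<omega>) powr \<rho>) \<partial>M) \<le> ennreal C" if \<rho>: "0 < \<rho>" for \<rho>
  proof (intro exI[of _ "exp (2 * K * \<rho>) * exp (\<rho>\<^sup>2 * T / 2)"] conjI allI impI)
    fix s t assume st: "0 \<le> s \<and> s \<le> t \<and> t \<le> T"
    then have [measurable]: "W s \<in> borel_measurable M" "W t \<in> borel_measurable M"
      by (auto intro: W_meas)
    have "(\<integral>\<^sup>+ \<omega>. ennreal ((g t \<omega> / g s \<omega>) powr \<rho>) \<partial>M)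
        \<le> (\<integral>\<^sup>+ \<omega>. ennreal (exp (2 * K * \<rho>)) * ennreal (exp (\<rho> * (W t \<omega> - W s \<omega>))) \<partial>M)"
    proof (rule nn_integral_mono_AE, use good in eventually_elim)
      fix \<omega> assume \<omega>: "\<omega> \<notin> E"
      have "g t \<omega> / g s \<omega> = exp ((W t \<omega> - W s \<omega>) - (t - s) / 2 + (?A t - ?A s))"
        using \<omega> by (simp add: g_def geom_bm_def W'_def exp_diff exp_add field_simps flip: exp_add exp_diff)
      then have "(g t \<omega> / g s \<omega>) powr \<rho> = exp (\<rho> * ((W t \<omega> - W s \<omega>) - (t - s) / 2 + (?A t - ?A s)))"
        by (simp add: powr_def)
      also have "\<dots> \<le> exp (2 * K * \<rho> + \<rho> * (W t \<omega> - W s \<omega>))"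
      proof -
        have "\<bar>?A t\<bar> \<le> K" "\<bar>?A s\<bar> \<le> K" "0 \<le> (t - s) / 2" using K st by auto
        then have "(W t \<omega> - W s \<omega>) - (t - s) / 2 + (?A t - ?A s) \<le> 2 * K + (W t \<omega> - W s \<omega>)"
          by linarith
        then have "\<rho> * ((W t \<omega> - W s \<omega>) - (t - s) / 2 + (?A t - ?A s)) \<le> \<rho> * (2 * K + (W t \<omega> - W s \<omega>))"
          using \<rho> by (intro mult_left_mono) auto
        then show ?thesis by (simp add: algebra_simps)
      qed
      finally show "ennreal ((g t \<omega> / g s \<omega>) powr \<rho>) \<le> ennreal (exp (2 * K * \<rho>)) * ennreal (exp (\<rho> * (W t \<omega> - W s \<omega>)))"
        by (simp add: exp_add ennreal_leI flip: ennreal_mult)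
    qed
    also have "\<dots> = ennreal (exp (2 * K * \<rho>)) * ennreal (exp (\<rho>\<^sup>2 * (t - s) / 2))"
      using st by (subst nn_integral_cmult) (auto simp: Brownian_increment_exponential_moment[OF M BM])
    also have "\<dots> \<le> ennreal (exp (2 * K * \<rho>)) * ennreal (exp (\<rho>\<^sup>2 * T / 2))"
      using st by (intro mult_left_mono ennreal_leI) (auto intro!: mult_left_mono)
    finally show "(\<integral>\<^sup>+ \<omega>. ennreal ((g t \<omega> / g s \<omega>) powr \<rho>) \<partial>M) \<le> ennreal (exp (2 * K * \<rho>) * exp (\<rho>\<^sup>2 * T / 2))"
      by (simp add: ennreal_mult)
  qed simp

  have z'_m: "(\<integral>\<^sup>+ \<omega>. ennreal ((\<bar>z' s \<omega>\<bar> / m s) powr p) \<partial>M) \<le> 1" if "s \<in> {0..T}" for s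
  proof -
    have "(\<integral>\<^sup>+ \<omega>. ennreal ((\<bar>z' s \<omega>\<bar> / m s) powr p) \<partial>M) = (\<integral>\<^sup>+ \<omega>. ennreal ((\<bar>z s \<omega>\<bar> / m s) powr p) \<partial>M)"
      by (rule nn_integral_cong_AE, use good in eventually_elim) (simp add: z'_def)
    then show ?thesis using z_m[OF that] by simp
  qed
  have F_le: "F t x \<le> L t * (1 + \<bar>x\<bar> powr \<alpha>)" if "t \<in> {0..T}" for t x
    using F_growth[OF that, of x] by linarith
  have J_zero: "J (\<lambda>_. 0) < \<infinity>"
    by (rule J_zero_finite[OF \<alpha> _ L_int L_nonneg F_le m_int m_ge z'_m g_moment]) (use p in auto)
  have ubar_J: "is_arg_min J (integrable ?\<Lambda>) ubar"
    using ubar_min unfolding cost_J .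
  then have J_fin: "J ubar < \<infinity>"
    using J_zero by (auto simp: is_arg_min_linorder intro: le_less_trans)
  have umin_J: "is_arg_min (\<lambda>u. J u + ennreal \<epsilon> * (\<integral>\<^sup>+x. ennreal (\<bar>u x\<bar> powr ptilde) \<partial>?\<Lambda>)) (integrable ?\<Lambda>) (umin \<epsilon>)"
    if "\<epsilon> > 0" for \<epsilon>
    using umin[OF that] unfolding pen_cost_def[abs_def] cost_J .
  have "sqrt 2 \<ge> 1" by simp
  then have q: "2 \<le> ptilde" using ptilde by linarith
  have ubar_q: "integrable ?\<Lambda> (\<lambda>x. \<bar>ubar x\<bar> powr ptilde)"
    using ubar_Lp by (simp add: in_Lp_def)

  define \<delta> where "\<delta> = (\<lambda>n. 1 / real (Suc n))"
  have \<delta>: "\<And>n. \<delta> n > 0" "decseq \<delta>" "\<delta> \<longlonglongrightarrow> 0"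
    using LIMSEQ_inverse_real_of_nat by (auto simp: \<delta>_def decseq_def frac_le inverse_eq_divide)
  have conv: "(\<lambda>n. \<integral>s. \<bar>umin (\<delta> n) s - ubar s\<bar> \<partial>?\<Lambda>) \<longlonglongrightarrow> 0"
    by (rule Tikhonov_minimizers_converge[OF q ubar_J J_fin ubar_q umin_J \<delta>])
  have u_int: "integrable ?\<Lambda> (umin (\<delta> n))" for n
    using umin[OF \<delta>(1)] by (simp add: is_arg_min_def)
  have ubar_int: "integrable ?\<Lambda> ubar" using ubar_min by (simp add: is_arg_min_def)
  have X0': "X0 \<in> borel_measurable M" using X0_L2 by (simp add: in_Lp_def)
  have version: "C_version M T (sol_map a W X0 u) (solution X0 u)" if "integrable ?\<Lambda> u" for u
    unfolding C_version_def
  proof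
    show "solution X0 u \<in> measurable M (C_borel T)" by (rule solution_measurable[OF X0' that])
    show "AE \<omega> in M. \<forall>t\<in>{0..T}. solution X0 u \<omega> t = sol_map a W X0 u t \<omega>"
      using good by eventually_elim (simp add: sol_good)
  qed
  have "conv_in_distr_C M T (\<lambda>n. sol_map a W X0 (umin (\<delta> n))) (sol_map a W X0 ubar)"
    unfolding conv_in_distr_C_def
  proof (intro exI conjI allI)
    show "C_version M T (sol_map a W X0 (umin (\<delta> n))) (solution X0 (umin (\<delta> n)))" for n
      by (rule version[OF u_int])
    show "C_version M T (sol_map a W X0 ubar) (solution X0 ubar)" by (rule version[OF ubar_int])
    show "weak_conv_C T (\<lambda>n. distr M (C_borel T) (solution X0 (umin (\<delta> n)))) (distr M (C_borel T) (solution X0 ubar))"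
    proof (rule AE_convergent_imp_weak_conv_C[OF M solution_measurable[OF X0' u_int] solution_measurable[OF X0' ubar_int]])
      show "AE \<omega> in M. (\<lambda>n. mdist (C_metric T) (solution X0 (umin (\<delta> n)) \<omega>) (solution X0 ubar \<omega>)) \<longlonglongrightarrow> 0"
        by (intro AE_I2 solution_converges[OF _ u_int ubar_int conv])
    qed
  qed
  with \<delta> show ?thesis by blast
qed

end
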